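(* Let $E/K$ be a finite Galois extension of fields with Galois group $G$ and let $\mathfrak{F}$ be a family of subgroups of $G$ containing the trivial subgroup. Then $\mathrm{H}^1_{\mathfrak{F}}(G,\underline{E}^{\times})=0$.
   Context: For a group $G$ and a family $\mathfrak{F}$ of subgroups, the orbit category $\mathcal{O}_{\mathfrak{F}}G$ has objects the left coset spaces $G/H$, $H\in\mathfrak{F}$, and morphisms all $G$-equivariant maps; $G/H\xrightarrow{x}G/K$ denotes the map sending $H$ to $xK$ (defined iff $x^{-1}Hx\subseteq K$). $\mathcal{O}_{\mathfrak{F}}G$-modules are contravariant functors $\mathcal{O}_{\mathfrak{F}}G\to\mathfrak{Ab}$; they form an abelian category with objectwise exactness. $\mathrm{H}^n_{\mathfrak{F}}(G,N)=\mathrm{Ext}^n_{\mathcal{O}_{\mathfrak{F}}G}(\underline{\mathbb{Z}},N)$, with $\underline{\mathbb{Z}}$ the constant functor $\mathbb{Z}$. $\underline{E}^{\times}$ is the fixed point functor of the $G$-module $E^\times$ ($G$ acting by field automorphisms): it sends $G/H$ to $(E^\times)^H$ and $G/H\xrightarrow{x}G/K$ to $(E^\times)^K\to(E^\times)^H$, $a\mapsto x(a)$. *)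

theory Defs
  imports "HOL-Algebra.Algebra"
begin

section \<open>The orbit category\<close>

text \<open>
  An object \<open>G/H\<close> of the orbit category is represented by the subgroup \<open>H\<close>, which is recovered
  from the coset space \<open>lcosets\<^bsub>G\<^esub> H\<close> as its only element that contains \<open>\<one>\<^bsub>G\<^esub>\<close>.
  No closure properties are required of a family of subgroups.
\<close>

definition subgroup_family :: "('g, 'm) monoid_scheme \<Rightarrow> 'g set set \<Rightarrow> bool" where
  "subgroup_family G F \<longleftrightarrow> (\<forall>H\<in>F. subgroup H G)"

definition orbit_hom ::
    "('g, 'm) monoid_scheme \<Rightarrow> 'g set \<Rightarrow> 'g set \<Rightarrow> ('g set \<Rightarrow> 'g set) set" where
  "orbit_hom G H L =
    {\<phi> \<in> (lcosets\<^bsub>G\<^esub> H) \<rightarrow>\<^sub>E (lcosets\<^bsub>G\<^esub> L).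
      \<forall>g\<in>carrier G. \<forall>c\<in>lcosets\<^bsub>G\<^esub> H. \<phi> (g <#\<^bsub>G\<^esub> c) = g <#\<^bsub>G\<^esub> \<phi> c}"


section \<open>Modules over the orbit category\<close>

text \<open>
  \<open>obj M H\<close> is the value \<open>M(G/H)\<close>, an abelian group written multiplicatively, and
  \<open>arr M H L \<phi>\<close> is the homomorphism \<open>M(G/L) \<rightarrow> M(G/H)\<close> induced by \<open>\<phi> : G/H \<rightarrow> G/L\<close>.
\<close>

record ('g, 'a) orb_mod =
  obj :: "'g set \<Rightarrow> 'a monoid"
  arr :: "'g set \<Rightarrow> 'g set \<Rightarrow> ('g set \<Rightarrow> 'g set) \<Rightarrow> 'a \<Rightarrow> 'a"

definition orbit_module ::
    "('g, 'm) monoid_scheme \<Rightarrow> 'g set set \<Rightarrow> ('g, 'a) orb_mod \<Rightarrow> bool" where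
  "orbit_module G F M \<longleftrightarrow>
    (\<forall>H\<in>F. comm_group (obj M H)) \<and>
    (\<forall>H\<in>F. \<forall>L\<in>F. \<forall>\<phi>\<in>orbit_hom G H L. arr M H L \<phi> \<in> hom (obj M L) (obj M H)) \<and>
    (\<forall>H\<in>F. \<forall>a\<in>carrier (obj M H). arr M H H (\<lambda>c\<in>lcosets\<^bsub>G\<^esub> H. c) a = a) \<and>
    (\<forall>H\<in>F. \<forall>L\<in>F. \<forall>N\<in>F. \<forall>\<phi>\<in>orbit_hom G H L. \<forall>\<psi>\<in>orbit_hom G L N. \<forall>a\<in>carrier (obj M N).
      arr M H N (compose (lcosets\<^bsub>G\<^esub> H) \<psi> \<phi>) a = arr M H L \<phi> (arr M L N \<psi> a))"

text \<open>
  Natural transformations, made extensional so that they are determined by their values.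
\<close>

definition orbit_module_hom ::
    "('g, 'm) monoid_scheme \<Rightarrow> 'g set set \<Rightarrow> ('g, 'a) orb_mod \<Rightarrow> ('g, 'b) orb_mod
      \<Rightarrow> ('g set \<Rightarrow> 'a \<Rightarrow> 'b) set" where
  "orbit_module_hom G F M N =
    {\<eta> \<in> \<Pi>\<^sub>E H\<in>F. hom (obj M H) (obj N H) \<inter> extensional (carrier (obj M H)).
      \<forall>H\<in>F. \<forall>L\<in>F. \<forall>\<phi>\<in>orbit_hom G H L. \<forall>a\<in>carrier (obj M L).
        \<eta> H (arr M H L \<phi> a) = arr N H L \<phi> (\<eta> L a)}"

definition orbit_module_comp ::
    "'g set set \<Rightarrow> ('g, 'a) orb_mod \<Rightarrow> ('g set \<Rightarrow> 'b \<Rightarrow> 'c) \<Rightarrow> ('g set \<Rightarrow> 'a \<Rightarrow> 'b)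
      \<Rightarrow> ('g set \<Rightarrow> 'a \<Rightarrow> 'c)" where
  "orbit_module_comp F M \<theta> \<eta> = (\<lambda>H\<in>F. compose (carrier (obj M H)) (\<theta> H) (\<eta> H))"

definition orbit_hom_group ::
    "('g, 'm) monoid_scheme \<Rightarrow> 'g set set \<Rightarrow> ('g, 'a) orb_mod \<Rightarrow> ('g, 'b) orb_mod
      \<Rightarrow> ('g set \<Rightarrow> 'a \<Rightarrow> 'b) monoid" where
  "orbit_hom_group G F M N =
    \<lparr>carrier = orbit_module_hom G F M N,
     monoid.mult = (\<lambda>\<eta> \<theta>. \<lambda>H\<in>F. \<lambda>a\<in>carrier (obj M H). \<eta> H a \<otimes>\<^bsub>obj N H\<^esub> \<theta> H a),
     one = (\<lambda>H\<in>F. \<lambda>a\<in>carrier (obj M H). \<one>\<^bsub>obj N H\<^esub>)\<rparr>"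

definition orbit_module_epi ::
    "'g set set \<Rightarrow> ('g, 'a) orb_mod \<Rightarrow> ('g, 'b) orb_mod \<Rightarrow> ('g set \<Rightarrow> 'a \<Rightarrow> 'b) \<Rightarrow> bool" where
  "orbit_module_epi F M N \<pi> \<longleftrightarrow>
    (\<forall>H\<in>F. \<pi> H ` carrier (obj M H) = carrier (obj N H))"

definition constant_module :: "'a monoid \<Rightarrow> ('g, 'a) orb_mod" where
  "constant_module A = \<lparr>obj = (\<lambda>_. A), arr = (\<lambda>_ _ _ a. a)\<rparr>"

text \<open>
  The fixed point functor of a \<open>G\<close>-module \<open>A\<close> with action \<open>act\<close>. If \<open>\<phi>\<close> maps \<open>H\<close> to \<open>xL\<close>,
  the choice of the representative \<open>x\<close> does not matter on elements fixed by \<open>L\<close>.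
\<close>

definition fixed_point_module :: "'a monoid \<Rightarrow> ('g \<Rightarrow> 'a \<Rightarrow> 'a) \<Rightarrow> ('g, 'a) orb_mod" where
  "fixed_point_module A act =
    \<lparr>obj = (\<lambda>H. A\<lparr>carrier := {a \<in> carrier A. \<forall>h\<in>H. act h a = a}\<rparr>),
     arr = (\<lambda>H L \<phi>. act (SOME x. x \<in> \<phi> H))\<rparr>"


section \<open>Projective resolutions and Ext\<close>

text \<open>
  A quantifier inside a definition ranges over the modules with elements in one fixed type. The
  type of \<open>A\<close> below is large enough for the free cover of \<open>P\<close>, so that the lifting property
  against modules \<open>A\<close>, \<open>B\<close> of these types implies it against modules of arbitrary types; this is
  theorem \<open>orbit_projective_lift\<close> at the end of this theory.
\<close>

definition orbit_projective ::
    "('g, 'm) monoid_scheme \<Rightarrow> 'g set set \<Rightarrow> ('g, 'p) orb_mod \<Rightarrow> bool" where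
  "orbit_projective G F P \<longleftrightarrow> orbit_module G F P \<and>
    (\<forall>(A :: ('g, (('g set \<Rightarrow> 'g set) \<times> 'g set \<times> 'p) \<Rightarrow>\<^sub>0 int) orb_mod) (B :: ('g, 'p) orb_mod) \<pi> \<eta>.
      orbit_module G F A \<longrightarrow> orbit_module G F B \<longrightarrow>
      \<pi> \<in> orbit_module_hom G F A B \<longrightarrow> orbit_module_epi F A B \<pi> \<longrightarrow>
      \<eta> \<in> orbit_module_hom G F P B \<longrightarrow>
      (\<exists>\<theta>\<in>orbit_module_hom G F P A. orbit_module_comp F P \<pi> \<theta> = \<eta>))"

text \<open>
  An exact sequence \<open>\<dots> \<rightarrow> P 2 \<rightarrow> P 1 \<rightarrow> P 0 \<rightarrow> M \<rightarrow> 0\<close> with projective \<open>P n\<close>, where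
  \<open>d n : P (n + 1) \<rightarrow> P n\<close> and \<open>\<epsilon> : P 0 \<rightarrow> M\<close>.
\<close>

definition projective_resolution ::
    "('g, 'm) monoid_scheme \<Rightarrow> 'g set set \<Rightarrow> ('g, 'a) orb_mod
      \<Rightarrow> (nat \<Rightarrow> ('g, 'p) orb_mod) \<Rightarrow> (nat \<Rightarrow> 'g set \<Rightarrow> 'p \<Rightarrow> 'p) \<Rightarrow> ('g set \<Rightarrow> 'p \<Rightarrow> 'a) \<Rightarrow> bool" where
  "projective_resolution G F M P d \<epsilon> \<longleftrightarrow>
    (\<forall>n. orbit_projective G F (P n)) \<and>
    (\<forall>n. d n \<in> orbit_module_hom G F (P (Suc n)) (P n)) \<and>
    \<epsilon> \<in> orbit_module_hom G F (P 0) M \<and> orbit_module_epi F (P 0) M \<epsilon> \<and>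
    (\<forall>H\<in>F. d 0 H ` carrier (obj (P 1) H) = kernel (obj (P 0) H) (obj M H) (\<epsilon> H)) \<and>
    (\<forall>n. \<forall>H\<in>F. d (Suc n) H ` carrier (obj (P (Suc (Suc n))) H)
        = kernel (obj (P (Suc n)) H) (obj (P n) H) (d n H))"

text \<open>
  \<open>ext_group G F P d N n\<close> is the \<open>n\<close>-th cohomology group of the cochain complex \<open>Hom(P, N)\<close>, which is
  \<open>Ext\<^sup>n(M, N)\<close> if \<open>P\<close> is a projective resolution of \<open>M\<close>. For \<open>M\<close> the constant functor with value the
  integers it is the Bredon cohomology \<open>H\<^sup>n\<^sub>F(G, N)\<close>; that such resolutions exist is theorem
  \<open>bar_resolution\<close> at the end of this theory.
\<close>

definition ext_cocycles ::
    "('g, 'm) monoid_scheme \<Rightarrow> 'g set set \<Rightarrow> (nat \<Rightarrow> ('g, 'p) orb_mod)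
      \<Rightarrow> (nat \<Rightarrow> 'g set \<Rightarrow> 'p \<Rightarrow> 'p) \<Rightarrow> ('g, 'b) orb_mod \<Rightarrow> nat \<Rightarrow> ('g set \<Rightarrow> 'p \<Rightarrow> 'b) set" where
  "ext_cocycles G F P d N n =
    kernel (orbit_hom_group G F (P n) N) (orbit_hom_group G F (P (Suc n)) N)
      (\<lambda>\<eta>. orbit_module_comp F (P (Suc n)) \<eta> (d n))"

definition ext_coboundaries ::
    "('g, 'm) monoid_scheme \<Rightarrow> 'g set set \<Rightarrow> (nat \<Rightarrow> ('g, 'p) orb_mod)
      \<Rightarrow> (nat \<Rightarrow> 'g set \<Rightarrow> 'p \<Rightarrow> 'p) \<Rightarrow> ('g, 'b) orb_mod \<Rightarrow> nat \<Rightarrow> ('g set \<Rightarrow> 'p \<Rightarrow> 'b) set" where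
  "ext_coboundaries G F P d N n =
    (case n of
      0 \<Rightarrow> {\<one>\<^bsub>orbit_hom_group G F (P 0) N\<^esub>}
    | Suc m \<Rightarrow> (\<lambda>\<eta>. orbit_module_comp F (P (Suc m)) \<eta> (d m)) ` orbit_module_hom G F (P m) N)"

definition ext_group ::
    "('g, 'm) monoid_scheme \<Rightarrow> 'g set set \<Rightarrow> (nat \<Rightarrow> ('g, 'p) orb_mod)
      \<Rightarrow> (nat \<Rightarrow> 'g set \<Rightarrow> 'p \<Rightarrow> 'p) \<Rightarrow> ('g, 'b) orb_mod \<Rightarrow> nat \<Rightarrow> ('g set \<Rightarrow> 'p \<Rightarrow> 'b) set monoid" where
  "ext_group G F P d N n =
    (orbit_hom_group G F (P n) N)\<lparr>carrier := ext_cocycles G F P d N n\<rparr>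
      Mod ext_coboundaries G F P d N n"


section \<open>Finite Galois extensions\<close>

text \<open>
  \<open>E\<close> is finite, normal and separable over its subfield \<open>K\<close>. Since the minimal polynomials split
  over \<open>E\<close>, separability can be tested by the multiplicities of their roots in \<open>E\<close>.
\<close>

definition finite_galois_extension :: "('e, 'm) ring_scheme \<Rightarrow> 'e set \<Rightarrow> bool" where
  "finite_galois_extension E K \<longleftrightarrow>
    field E \<and> subfield K E \<and> ring.finite_dimension E K (carrier E) \<and>
    (\<forall>x\<in>carrier E.
      ring.splitted E (ring.Irr E K x) \<and>
      (\<forall>a. count (ring.roots E (ring.Irr E K x)) a \<le> 1))"

definition galois_group :: "('e, 'm) ring_scheme \<Rightarrow> 'e set \<Rightarrow> ('e \<Rightarrow> 'e) monoid" where
  "galois_group E K =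
    (BijGroup (carrier E))
      \<lparr>carrier := {\<sigma> \<in> Bij (carrier E). \<sigma> \<in> ring_iso E E \<and> (\<forall>a\<in>K. \<sigma> a = a)}\<rparr>"

text \<open>The fixed point functor of the \<open>Gal(E/K)\<close>-module \<open>E\<^sup>\<times>\<close>.\<close>

definition galois_units_module :: "('e, 'm) ring_scheme \<Rightarrow> ('e \<Rightarrow> 'e, 'e) orb_mod" where
  "galois_units_module E = fixed_point_module (mult_of E) (\<lambda>\<sigma> a. \<sigma> a)"


section \<open>Adequacy of the definition of projectivity\<close>

lemma lcosets_act_closed:
  assumes "group G" "subgroup H G" "g \<in> carrier G" "c \<in> lcosets\<^bsub>G\<^esub> H"
  shows "g <#\<^bsub>G\<^esub> c \<in> lcosets\<^bsub>G\<^esub> H"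
proof -
  interpret group G by fact
  from assms(4) obtain x where x: "x \<in> carrier G" "c = x <#\<^bsub>G\<^esub> H"
    by (auto simp: LCOSETS_def)
  have "g <#\<^bsub>G\<^esub> c = (g \<otimes>\<^bsub>G\<^esub> x) <#\<^bsub>G\<^esub> H"
    using x assms subgroup.subset[OF assms(2)] by (simp add: lcos_m_assoc)
  then show ?thesis using x assms by (auto simp: LCOSETS_def)
qed

lemma orbit_hom_id:
  assumes "group G" "subgroup H G"
  shows "(\<lambda>c\<in>lcosets\<^bsub>G\<^esub> H. c) \<in> orbit_hom G H H"
  using lcosets_act_closed[OF assms] by (auto simp: orbit_hom_def)

lemma orbit_hom_funcset: "\<phi> \<in> orbit_hom G H L \<Longrightarrow> \<phi> \<in> (lcosets\<^bsub>G\<^esub> H) \<rightarrow> (lcosets\<^bsub>G\<^esub> L)"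
  by (auto simp: orbit_hom_def PiE_def)

lemma orbit_hom_ext: "\<phi> \<in> orbit_hom G H L \<Longrightarrow> \<phi> \<in> extensional (lcosets\<^bsub>G\<^esub> H)"
  by (auto simp: orbit_hom_def PiE_def)

lemma orbit_module_hom_D:
  assumes "\<eta> \<in> orbit_module_hom G F M N" "H \<in> F"
  shows "\<eta> H \<in> hom (obj M H) (obj N H)" "\<eta> H \<in> extensional (carrier (obj M H))"
    "\<And>x. x \<in> carrier (obj M H) \<Longrightarrow> \<eta> H x \<in> carrier (obj N H)"
  using assms by (auto simp: orbit_module_hom_def PiE_iff hom_def)

lemma orbit_module_arr_closed:
  assumes "orbit_module G F M" "H \<in> F" "L \<in> F" "\<phi> \<in> orbit_hom G H L" "x \<in> carrier (obj M L)"
  shows "arr M H L \<phi> x \<in> carrier (obj M H)"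
  using assms hom_in_carrier unfolding orbit_module_def by metis

lemma orbit_module_monoid: "orbit_module G F M \<Longrightarrow> H \<in> F \<Longrightarrow> monoid (obj M H)"
  unfolding orbit_module_def comm_group_def comm_monoid_def by blast

lemma orbit_module_hom_nat:
  assumes "\<eta> \<in> orbit_module_hom G F M N" "H \<in> F" "L \<in> F" "\<phi> \<in> orbit_hom G H L" "a \<in> carrier (obj M L)"
  shows "\<eta> H (arr M H L \<phi> a) = arr N H L \<phi> (\<eta> L a)"
  using assms by (simp add: orbit_module_hom_def)

lemma orbit_module_hom_I:
  assumes "\<And>H. H \<in> F \<Longrightarrow> \<eta> H \<in> hom (obj M H) (obj N H)"
    and "\<And>H. H \<in> F \<Longrightarrow> \<eta> H \<in> extensional (carrier (obj M H))" and "\<eta> \<in> extensional F"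
    and "\<And>H L \<phi> a. H \<in> F \<Longrightarrow> L \<in> F \<Longrightarrow> \<phi> \<in> orbit_hom G H L \<Longrightarrow> a \<in> carrier (obj M L) \<Longrightarrow>
      \<eta> H (arr M H L \<phi> a) = arr N H L \<phi> (\<eta> L a)"
  shows "\<eta> \<in> orbit_module_hom G F M N"
  using assms by (simp add: orbit_module_hom_def PiE_iff)

lemma orbit_module_comp_hom:
  assumes M: "orbit_module G F M"
    and \<theta>: "\<theta> \<in> orbit_module_hom G F M A" and \<pi>: "\<pi> \<in> orbit_module_hom G F A C"
  shows "orbit_module_comp F M \<pi> \<theta> \<in> orbit_module_hom G F M C"
proof (rule orbit_module_hom_I)
  fix H assume H: "H \<in> F"
  show "orbit_module_comp F M \<pi> \<theta> H \<in> extensional (carrier (obj M H))"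
    using H by (simp add: orbit_module_comp_def)
  have c: "orbit_module_comp F M \<pi> \<theta> H x = \<pi> H (\<theta> H x)" if "x \<in> carrier (obj M H)" for x
    using H that by (simp add: orbit_module_comp_def compose_def)
  show "orbit_module_comp F M \<pi> \<theta> H \<in> hom (obj M H) (obj C H)"
    using orbit_module_hom_D(1,3)[OF \<theta> H] orbit_module_hom_D(1,3)[OF \<pi> H]
      monoid.m_closed[OF orbit_module_monoid[OF M H]]
    by (intro homI) (simp_all add: c hom_mult)
next
  show "orbit_module_comp F M \<pi> \<theta> \<in> extensional F" by (simp add: orbit_module_comp_def)
next
  fix H L \<phi> a
  assume *: "H \<in> F" "L \<in> F" "\<phi> \<in> orbit_hom G H L" "a \<in> carrier (obj M L)"
  then show "orbit_module_comp F M \<pi> \<theta> H (arr M H L \<phi> a) = arr C H L \<phi> (orbit_module_comp F M \<pi> \<theta> L a)"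
    using orbit_module_arr_closed[OF M *] orbit_module_hom_D(3)[OF \<theta>] orbit_module_hom_nat[OF \<theta> *]
      orbit_module_hom_nat[OF \<pi> *(1-3)]
    by (simp add: orbit_module_comp_def compose_def)
qed

lemma orbit_hom_compose:
  assumes "group G" "subgroup H G" "\<phi> \<in> orbit_hom G H L" "\<psi> \<in> orbit_hom G L N"
  shows "compose (lcosets\<^bsub>G\<^esub> H) \<psi> \<phi> \<in> orbit_hom G H N"
  using assms lcosets_act_closed[OF assms(1,2)]
  by (auto simp: orbit_hom_def compose_def PiE_def Pi_def)

lemma orbit_comp_id:
  "\<phi> \<in> orbit_hom G H L \<Longrightarrow> compose (lcosets\<^bsub>G\<^esub> H) \<phi> (\<lambda>c\<in>lcosets\<^bsub>G\<^esub> H. c) = \<phi>"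
  by (rule compose_Id[OF orbit_hom_funcset orbit_hom_ext])

lemma orbit_id_comp:
  "\<phi> \<in> orbit_hom G H L \<Longrightarrow> compose (lcosets\<^bsub>G\<^esub> H) (\<lambda>c\<in>lcosets\<^bsub>G\<^esub> L. c) \<phi> = \<phi>"
  by (rule Id_compose[OF orbit_hom_funcset orbit_hom_ext])

lemma orbit_comp_assoc:
  "\<phi> \<in> orbit_hom G H L \<Longrightarrow>
    compose (lcosets\<^bsub>G\<^esub> H) \<chi> (compose (lcosets\<^bsub>G\<^esub> H) \<psi> \<phi>)
      = compose (lcosets\<^bsub>G\<^esub> H) (compose (lcosets\<^bsub>G\<^esub> L) \<chi> \<psi>) \<phi>"
  using compose_assoc[OF orbit_hom_funcset] .

text \<open>
  Modules that are free on a set of generators: every basis element \<open>b\<close> of \<open>M(G/L)\<close> is the image of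
  a generator \<open>gen b\<close> in \<open>M(G/dom b)\<close> under a unique \<open>mor b : G/L \<rightarrow> G/dom b\<close>.
\<close>

locale orbit_free =
  fixes G :: "('g, 'm) monoid_scheme" and F :: "'g set set" and M :: "('g, 'k \<Rightarrow>\<^sub>0 int) orb_mod"
    and B :: "'g set \<Rightarrow> 'k set" and act :: "'g set \<Rightarrow> ('g set \<Rightarrow> 'g set) \<Rightarrow> 'k \<Rightarrow> 'k"
    and dom :: "'k \<Rightarrow> 'g set" and gen :: "'k \<Rightarrow> 'k" and mor :: "'k \<Rightarrow> 'g set \<Rightarrow> 'g set"
  assumes group_G: "group G" and fam: "subgroup_family G F"
    and obj_M: "\<And>L. L \<in> F \<Longrightarrow> obj M L = free_Abelian_group (B L)"
    and arr_M: "\<And>H L \<phi>. arr M H L \<phi> = frag_extend (frag_of \<circ> act H \<phi>)"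
    and act_closed: "\<And>H L \<phi> b. H \<in> F \<Longrightarrow> L \<in> F \<Longrightarrow> \<phi> \<in> orbit_hom G H L \<Longrightarrow> b \<in> B L \<Longrightarrow> act H \<phi> b \<in> B H"
    and dom_F: "\<And>L b. L \<in> F \<Longrightarrow> b \<in> B L \<Longrightarrow> dom b \<in> F"
    and mor_hom: "\<And>L b. L \<in> F \<Longrightarrow> b \<in> B L \<Longrightarrow> mor b \<in> orbit_hom G L (dom b)"
    and gen_B: "\<And>L b. L \<in> F \<Longrightarrow> b \<in> B L \<Longrightarrow> gen b \<in> B (dom b)"
    and dom_gen: "\<And>L b. L \<in> F \<Longrightarrow> b \<in> B L \<Longrightarrow> dom (gen b) = dom b"
    and act_gen: "\<And>L b. L \<in> F \<Longrightarrow> b \<in> B L \<Longrightarrow> act L (mor b) (gen b) = b"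
    and dom_act: "\<And>H L \<phi> b. H \<in> F \<Longrightarrow> L \<in> F \<Longrightarrow> \<phi> \<in> orbit_hom G H L \<Longrightarrow> b \<in> B L \<Longrightarrow> dom (act H \<phi> b) = dom b"
    and gen_act: "\<And>H L \<phi> b. H \<in> F \<Longrightarrow> L \<in> F \<Longrightarrow> \<phi> \<in> orbit_hom G H L \<Longrightarrow> b \<in> B L \<Longrightarrow> gen (act H \<phi> b) = gen b"
    and mor_act: "\<And>H L \<phi> b. H \<in> F \<Longrightarrow> L \<in> F \<Longrightarrow> \<phi> \<in> orbit_hom G H L \<Longrightarrow> b \<in> B L \<Longrightarrow>
        mor (act H \<phi> b) = compose (lcosets\<^bsub>G\<^esub> H) (mor b) \<phi>"
begin

lemma sub: "H \<in> F \<Longrightarrow> subgroup H G"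
  using fam by (simp add: subgroup_family_def)

lemma act_eq:
  assumes "H \<in> F" "L \<in> F" "\<phi> \<in> orbit_hom G H L" "b \<in> B L"
  shows "act H \<phi> b = act H (compose (lcosets\<^bsub>G\<^esub> H) (mor b) \<phi>) (gen b)"
  using act_gen[OF assms(1) act_closed[OF assms]] gen_act[OF assms] mor_act[OF assms] by simp

lemma act_id:
  assumes "H \<in> F" "b \<in> B H"
  shows "act H (\<lambda>c\<in>lcosets\<^bsub>G\<^esub> H. c) b = b"
  using act_eq[OF assms(1,1) orbit_hom_id[OF group_G sub[OF assms(1)]] assms(2)]
    orbit_comp_id[OF mor_hom[OF assms]] act_gen[OF assms] by simp

lemma act_act:
  assumes "H \<in> F" "L \<in> F" "N \<in> F" "\<phi> \<in> orbit_hom G H L" "\<psi> \<in> orbit_hom G L N" "b \<in> B N"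
  shows "act H (compose (lcosets\<^bsub>G\<^esub> H) \<psi> \<phi>) b = act H \<phi> (act L \<psi> b)"
proof -
  have "act H \<phi> (act L \<psi> b) = act H (compose (lcosets\<^bsub>G\<^esub> H) (mor (act L \<psi> b)) \<phi>) (gen (act L \<psi> b))"
    by (rule act_eq) (use assms act_closed in auto)
  also have "\<dots> = act H (compose (lcosets\<^bsub>G\<^esub> H) (compose (lcosets\<^bsub>G\<^esub> L) (mor b) \<psi>) \<phi>) (gen b)"
    using assms by (simp add: mor_act gen_act)
  also have "\<dots> = act H (compose (lcosets\<^bsub>G\<^esub> H) (mor b) (compose (lcosets\<^bsub>G\<^esub> H) \<psi> \<phi>)) (gen b)"
    using orbit_comp_assoc[OF assms(4)] by metis
  also have "\<dots> = act H (compose (lcosets\<^bsub>G\<^esub> H) \<psi> \<phi>) b"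
    using act_eq[OF assms(1,3) orbit_hom_compose[OF group_G sub[OF assms(1)] assms(4,5)] assms(6)] by simp
  finally show ?thesis by simp
qed

lemma arr_keys:
  assumes "H \<in> F" "L \<in> F" "\<phi> \<in> orbit_hom G H L" "Poly_Mapping.keys c \<subseteq> B L"
  shows "Poly_Mapping.keys (arr M H L \<phi> c) \<subseteq> B H"
  using keys_frag_extend[of "frag_of \<circ> act H \<phi>" c] act_closed[OF assms(1-3)] assms(4)
  by (fastforce simp: arr_M)

lemma module: "orbit_module G F M"
  unfolding orbit_module_def
proof (intro conjI ballI)
  show "comm_group (obj M H)" if "H \<in> F" for H
    using that by (simp add: obj_M abelian_free_Abelian_group)
  show "arr M H L \<phi> \<in> hom (obj M L) (obj M H)"
    if "H \<in> F" "L \<in> F" "\<phi> \<in> orbit_hom G H L" for H L \<phi>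
    using arr_keys[OF that] that by (auto simp: obj_M hom_def arr_M frag_extend_add)
  show "arr M H H (\<lambda>c\<in>lcosets\<^bsub>G\<^esub> H. c) a = a" if "H \<in> F" "a \<in> carrier (obj M H)" for H a
  proof -
    have "arr M H H (\<lambda>c\<in>lcosets\<^bsub>G\<^esub> H. c) a = frag_extend frag_of a"
      unfolding arr_M by (rule frag_extend_eq) (use that act_id in \<open>auto simp: obj_M\<close>)
    then show ?thesis by (simp flip: frag_expansion)
  qed
  show "arr M H N (compose (lcosets\<^bsub>G\<^esub> H) \<psi> \<phi>) a = arr M H L \<phi> (arr M L N \<psi> a)"
    if "H \<in> F" "L \<in> F" "N \<in> F" "\<phi> \<in> orbit_hom G H L" "\<psi> \<in> orbit_hom G L N" "a \<in> carrier (obj M N)"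
    for H L N \<phi> \<psi> a
    unfolding arr_M frag_extend_compose
    by (rule frag_extend_eq) (use that act_act[OF that(1-5)] in \<open>auto simp: obj_M\<close>)
qed

lemma hom_unique:
  assumes N: "orbit_module G F N"
    and \<eta>: "\<eta> \<in> orbit_module_hom G F M N" and \<theta>: "\<theta> \<in> orbit_module_hom G F M N"
    and eq: "\<And>L b. L \<in> F \<Longrightarrow> b \<in> B L \<Longrightarrow> \<eta> L (frag_of b) = \<theta> L (frag_of b)"
  shows "\<eta> = \<theta>"
proof
  fix L
  show "\<eta> L = \<theta> L"
  proof (cases "L \<in> F")
    case False
    then show ?thesis using \<eta> \<theta> by (simp add: orbit_module_hom_def PiE_iff extensional_def)
  next
    case True
    have h: "\<eta> L \<in> hom (free_Abelian_group (B L)) (obj N L)" "\<theta> L \<in> hom (free_Abelian_group (B L)) (obj N L)"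
      and e: "\<eta> L \<in> extensional (carrier (free_Abelian_group (B L)))" "\<theta> L \<in> extensional (carrier (free_Abelian_group (B L)))"
      using orbit_module_hom_D[OF \<eta> True] orbit_module_hom_D[OF \<theta> True] obj_M[OF True] by simp_all
    have gr: "group (obj N L)"
      using N True by (simp add: orbit_module_def comm_group.axioms)
    interpret h1: group_hom "free_Abelian_group (B L)" "obj N L" "\<eta> L"
      using h gr by (simp add: group_hom_def group_hom_axioms_def)
    interpret h2: group_hom "free_Abelian_group (B L)" "obj N L" "\<theta> L"
      using h gr by (simp add: group_hom_def group_hom_axioms_def)
    have "\<eta> L c = \<theta> L c" if "Poly_Mapping.keys c \<subseteq> B L" for c
      using that
    proof (induction c rule: free_Abelian_group_induct[consumes 1, case_names zero diff gen])
      case zero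
      show ?case using h1.hom_one h2.hom_one by simp
    next
      case (diff x y)
      have "f (x - y) = f x \<otimes>\<^bsub>obj N L\<^esub> inv\<^bsub>obj N L\<^esub> f y"
        if "group_hom (free_Abelian_group (B L)) (obj N L) f" for f
      proof -
        interpret f: group_hom "free_Abelian_group (B L)" "obj N L" f by fact
        show ?thesis using diff(1,2) f.hom_mult[of x "- y"] f.hom_inv[of y] by simp
      qed
      from this[OF h1.group_hom_axioms] this[OF h2.group_hom_axioms] diff show ?case by simp
    next
      case (gen a)
      then show ?case using eq True by simp
    qed
    then show ?thesis
      by (intro extensionalityI[OF e]) simp
  qed
qed

lemma hom_exists:
  assumes N: "orbit_module G F N"
    and a: "\<And>L b. L \<in> F \<Longrightarrow> b \<in> B L \<Longrightarrow> a (gen b) \<in> carrier (obj N (dom b))"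
  obtains h where "h \<in> orbit_module_hom G F M N"
    "\<And>L b. L \<in> F \<Longrightarrow> b \<in> B L \<Longrightarrow> h L (frag_of b) = arr N L (dom b) (mor b) (a (gen b))"
proof -
  have Nhom: "arr N H L \<phi> \<in> hom (obj N L) (obj N H)"
    if "H \<in> F" "L \<in> F" "\<phi> \<in> orbit_hom G H L" for H L \<phi>
    using N that by (simp add: orbit_module_def)
  have Ncomp: "arr N H K (compose (lcosets\<^bsub>G\<^esub> H) \<psi> \<phi>) x = arr N H L \<phi> (arr N L K \<psi> x)"
    if "H \<in> F" "L \<in> F" "K \<in> F" "\<phi> \<in> orbit_hom G H L" "\<psi> \<in> orbit_hom G L K" "x \<in> carrier (obj N K)"
    for H L K \<phi> \<psi> x
    using N that by (simp add: orbit_module_def)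
  have Ngrp: "comm_group (obj N L)" if "L \<in> F" for L
    using N that by (simp add: orbit_module_def)
  have "\<exists>h. L \<in> F \<longrightarrow> h \<in> hom (free_Abelian_group (B L)) (obj N L) \<and>
      (\<forall>b\<in>B L. h (frag_of b) = arr N L (dom b) (mor b) (a (gen b)))" for L
  proof (cases "L \<in> F")
    case True
    have sub: "(\<lambda>b. arr N L (dom b) (mor b) (a (gen b))) ` B L \<subseteq> carrier (obj N L)"
      using True hom_in_carrier[OF Nhom[OF True dom_F mor_hom] a] by blast
    from comm_group.free_Abelian_group_universal[OF Ngrp[OF True] sub] show ?thesis by metis
  qed simp
  then obtain h0 where h0: "\<And>L. L \<in> F \<Longrightarrow> h0 L \<in> hom (free_Abelian_group (B L)) (obj N L)"
      "\<And>L b. L \<in> F \<Longrightarrow> b \<in> B L \<Longrightarrow> h0 L (frag_of b) = arr N L (dom b) (mor b) (a (gen b))"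
    by metis
  define h where "h = (\<lambda>L\<in>F. restrict (h0 L) (carrier (obj M L)))"
  have nat: "h0 H (arr M H L \<phi> c) = arr N H L \<phi> (h0 L c)"
    if H: "H \<in> F" and L: "L \<in> F" and \<phi>: "\<phi> \<in> orbit_hom G H L" and c: "Poly_Mapping.keys c \<subseteq> B L" for H L \<phi> c
    using c
  proof (induction c rule: free_Abelian_group_induct[consumes 1, case_names zero diff gen])
    case zero
    interpret f: group_hom "free_Abelian_group (B L)" "obj N L" "h0 L"
      using h0(1)[OF L] Ngrp[OF L] by (simp add: group_hom_def group_hom_axioms_def comm_group.axioms)
    interpret f': group_hom "free_Abelian_group (B H)" "obj N H" "h0 H"
      using h0(1)[OF H] Ngrp[OF H] by (simp add: group_hom_def group_hom_axioms_def comm_group.axioms)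
    interpret f'': group_hom "obj N L" "obj N H" "arr N H L \<phi>"
      using Nhom[OF H L \<phi>] Ngrp[OF H] Ngrp[OF L] by (simp add: group_hom_def group_hom_axioms_def comm_group.axioms)
    show ?case using f.hom_one f'.hom_one f''.hom_one by (simp add: arr_M)
  next
    case (diff x y)
    interpret f: group_hom "free_Abelian_group (B L)" "obj N L" "h0 L"
      using h0(1)[OF L] Ngrp[OF L] by (simp add: group_hom_def group_hom_axioms_def comm_group.axioms)
    interpret f': group_hom "free_Abelian_group (B H)" "obj N H" "h0 H"
      using h0(1)[OF H] Ngrp[OF H] by (simp add: group_hom_def group_hom_axioms_def comm_group.axioms)
    interpret f'': group_hom "obj N L" "obj N H" "arr N H L \<phi>"
      using Nhom[OF H L \<phi>] Ngrp[OF H] Ngrp[OF L] by (simp add: group_hom_def group_hom_axioms_def comm_group.axioms)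
    have k: "Poly_Mapping.keys (arr M H L \<phi> x) \<subseteq> B H" "Poly_Mapping.keys (arr M H L \<phi> y) \<subseteq> B H"
      using arr_keys[OF H L \<phi>] diff by auto
    have "arr M H L \<phi> (x - y) = arr M H L \<phi> x - arr M H L \<phi> y"
      by (simp add: arr_M frag_extend_diff)
    then have "h0 H (arr M H L \<phi> (x - y))
        = h0 H (arr M H L \<phi> x) \<otimes>\<^bsub>obj N H\<^esub> inv\<^bsub>obj N H\<^esub> h0 H (arr M H L \<phi> y)"
      using k f'.hom_mult[of "arr M H L \<phi> x" "- arr M H L \<phi> y"] f'.hom_inv[of "arr M H L \<phi> y"] by simp
    also have "\<dots> = arr N H L \<phi> (h0 L x \<otimes>\<^bsub>obj N L\<^esub> inv\<^bsub>obj N L\<^esub> h0 L y)"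
      using diff by simp
    also have "h0 L x \<otimes>\<^bsub>obj N L\<^esub> inv\<^bsub>obj N L\<^esub> h0 L y = h0 L (x - y)"
      using diff f.hom_mult[of x "- y"] f.hom_inv[of y] by simp
    finally show ?case .
  next
    case (gen b)
    have "h0 H (arr M H L \<phi> (frag_of b)) = arr N H (dom b) (compose (lcosets\<^bsub>G\<^esub> H) (mor b) \<phi>) (a (gen b))"
      using H L \<phi> gen by (simp add: arr_M h0 act_closed dom_act mor_act gen_act)
    also have "\<dots> = arr N H L \<phi> (h0 L (frag_of b))"
      using Ncomp[OF H L dom_F[OF L gen] \<phi> mor_hom[OF L gen] a[OF L gen]] h0(2)[OF L gen] by simp
    finally show ?case .
  qed
  have "h \<in> orbit_module_hom G F M N"
    unfolding orbit_module_hom_def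
  proof (intro CollectI conjI ballI PiE_I IntI)
    fix L assume L: "L \<in> F"
    show "h L \<in> hom (obj M L) (obj N L)"
      unfolding obj_M[OF L] by (rule group.hom_restrict[OF group_free_Abelian_group h0(1)[OF L]]) (simp add: h_def L obj_M)
    show "h L \<in> extensional (carrier (obj M L))" by (simp add: h_def L)
  next
    fix L assume "L \<notin> F" then show "h L = undefined" by (simp add: h_def)
  next
    fix H L \<phi> c assume *: "H \<in> F" "L \<in> F" "\<phi> \<in> orbit_hom G H L" "c \<in> carrier (obj M L)"
    then show "h H (arr M H L \<phi> c) = arr N H L \<phi> (h L c)"
      using nat[OF *(1-3)] arr_keys[OF *(1-3)] by (simp add: h_def obj_M)
  qed
  moreover have "h L (frag_of b) = arr N L (dom b) (mor b) (a (gen b))" if "L \<in> F" "b \<in> B L" for L b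
    using that h0 by (simp add: h_def obj_M)
  ultimately show ?thesis using that by blast
qed

lemma lift:
  assumes A: "orbit_module G F A" and C: "orbit_module G F C"
    and \<pi>: "\<pi> \<in> orbit_module_hom G F A C" and epi: "orbit_module_epi F A C \<pi>"
    and \<eta>: "\<eta> \<in> orbit_module_hom G F M C"
  shows "\<exists>\<theta>\<in>orbit_module_hom G F M A. orbit_module_comp F M \<pi> \<theta> = \<eta>"
proof -
  define a where "a = (\<lambda>g. SOME y. y \<in> carrier (obj A (dom g)) \<and> \<pi> (dom g) y = \<eta> (dom g) (frag_of g))"
  have a: "a (gen b) \<in> carrier (obj A (dom b)) \<and> \<pi> (dom b) (a (gen b)) = \<eta> (dom b) (frag_of (gen b))"
    if L: "L \<in> F" and b: "b \<in> B L" for L b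
  proof -
    have "\<eta> (dom b) (frag_of (gen b)) \<in> carrier (obj C (dom b))"
      using \<eta> dom_F[OF L b] gen_B[OF L b] by (simp add: orbit_module_hom_D(3) obj_M)
    then have "\<exists>y. y \<in> carrier (obj A (dom b)) \<and> \<pi> (dom b) y = \<eta> (dom b) (frag_of (gen b))"
      using epi dom_F[OF L b] unfolding orbit_module_epi_def by (metis imageE)
    from someI_ex[OF this] show ?thesis by (simp add: a_def dom_gen[OF L b])
  qed
  obtain \<theta> where \<theta>: "\<theta> \<in> orbit_module_hom G F M A"
    and \<theta>_of: "\<And>L b. L \<in> F \<Longrightarrow> b \<in> B L \<Longrightarrow> \<theta> L (frag_of b) = arr A L (dom b) (mor b) (a (gen b))"
    using hom_exists[OF A] a by blast
  have "orbit_module_comp F M \<pi> \<theta> = \<eta>"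
  proof (rule hom_unique[OF C orbit_module_comp_hom[OF module \<theta> \<pi>] \<eta>])
    fix L b assume L: "L \<in> F" and b: "b \<in> B L"
    have "orbit_module_comp F M \<pi> \<theta> L (frag_of b) = \<pi> L (arr A L (dom b) (mor b) (a (gen b)))"
      using L b by (simp add: orbit_module_comp_def compose_def obj_M \<theta>_of)
    also have "\<dots> = arr C L (dom b) (mor b) (\<pi> (dom b) (a (gen b)))"
      using orbit_module_hom_nat[OF \<pi> L dom_F[OF L b] mor_hom[OF L b]] a[OF L b] by simp
    also have "\<dots> = arr C L (dom b) (mor b) (\<eta> (dom b) (frag_of (gen b)))"
      using a[OF L b] by simp
    also have "\<dots> = \<eta> L (arr M L (dom b) (mor b) (frag_of (gen b)))"
      using orbit_module_hom_nat[OF \<eta> L dom_F[OF L b] mor_hom[OF L b]] gen_B[OF L b] dom_F[OF L b]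
      by (simp add: obj_M)
    also have "\<dots> = \<eta> L (frag_of b)"
      using act_gen[OF L b] by (simp add: arr_M)
    finally show "orbit_module_comp F M \<pi> \<theta> L (frag_of b) = \<eta> L (frag_of b)" .
  qed
  with \<theta> show ?thesis by blast
qed

lemma projective: "orbit_projective G F M"
  unfolding orbit_projective_def using module lift by blast

end

text \<open>The free cover of \<open>P\<close>, with one generator in \<open>G/H\<close> for each element of \<open>P(G/H)\<close>.\<close>

definition cover_basis ::
    "('g, 'm) monoid_scheme \<Rightarrow> 'g set set \<Rightarrow> ('g, 'p) orb_mod \<Rightarrow> 'g set
      \<Rightarrow> (('g set \<Rightarrow> 'g set) \<times> 'g set \<times> 'p) set" where
  "cover_basis G F P L =
    {(\<phi>, H, x). H \<in> F \<and> \<phi> \<in> orbit_hom G L H \<and> x \<in> carrier (obj P H)}"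

definition cover_act ::
    "('g, 'm) monoid_scheme \<Rightarrow> 'g set \<Rightarrow> ('g set \<Rightarrow> 'g set)
      \<Rightarrow> ('g set \<Rightarrow> 'g set) \<times> 'g set \<times> 'p \<Rightarrow> ('g set \<Rightarrow> 'g set) \<times> 'g set \<times> 'p" where
  "cover_act G H \<psi> = (\<lambda>(\<phi>, s). (compose (lcosets\<^bsub>G\<^esub> H) \<phi> \<psi>, s))"

definition cover_module ::
    "('g, 'm) monoid_scheme \<Rightarrow> 'g set set \<Rightarrow> ('g, 'p) orb_mod
      \<Rightarrow> ('g, (('g set \<Rightarrow> 'g set) \<times> 'g set \<times> 'p) \<Rightarrow>\<^sub>0 int) orb_mod" where
  "cover_module G F P =
    \<lparr>obj = (\<lambda>L. free_Abelian_group (cover_basis G F P L)),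
     arr = (\<lambda>H L \<psi>. frag_extend (frag_of \<circ> cover_act G H \<psi>))\<rparr>"

lemma orbit_free_cover:
  assumes "group G" "subgroup_family G F"
  shows "orbit_free G F (cover_module G F P) (cover_basis G F P) (cover_act G)
    (\<lambda>b. fst (snd b)) (\<lambda>(\<phi>, H, x). (\<lambda>c\<in>lcosets\<^bsub>G\<^esub> H. c, H, x)) fst"
  using assms
  by (intro orbit_free.intro)
    (auto simp: cover_module_def cover_basis_def cover_act_def subgroup_family_def orbit_id_comp
      intro!: orbit_hom_compose orbit_hom_id)

theorem orbit_projective_lift:
  fixes A :: "('g, 'a) orb_mod" and C :: "('g, 'c) orb_mod" and P :: "('g, 'p) orb_mod"
  assumes G: "group G" "subgroup_family G F" and P: "orbit_projective G F P"
    and A: "orbit_module G F A" and C: "orbit_module G F C"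
    and \<pi>: "\<pi> \<in> orbit_module_hom G F A C" and epi: "orbit_module_epi F A C \<pi>"
    and \<eta>: "\<eta> \<in> orbit_module_hom G F P C"
  shows "\<exists>\<theta>\<in>orbit_module_hom G F P A. orbit_module_comp F P \<pi> \<theta> = \<eta>"
proof -
  interpret cov: orbit_free G F "cover_module G F P" "cover_basis G F P" "cover_act G"
    "\<lambda>b. fst (snd b)" "\<lambda>(\<phi>, H, x). (\<lambda>c\<in>lcosets\<^bsub>G\<^esub> H. c, H, x)" fst
    by (rule orbit_free_cover[OF G])
  let ?M = "cover_module G F P"
  have Pm: "orbit_module G F P" using P by (simp add: orbit_projective_def)
  obtain q where q: "q \<in> orbit_module_hom G F ?M P"
    and q_of: "\<And>L b. L \<in> F \<Longrightarrow> b \<in> cover_basis G F P L \<Longrightarrow>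
      q L (frag_of b) = arr P L (fst (snd b)) (fst b) (snd (snd (case b of (\<phi>, H, x) \<Rightarrow> (\<lambda>c\<in>lcosets\<^bsub>G\<^esub> H. c, H, x))))"
    by (rule cov.hom_exists[OF Pm, of "\<lambda>b. snd (snd b)"]) (auto simp: cover_basis_def)
  have "orbit_module_epi F ?M P q"
    unfolding orbit_module_epi_def
  proof (intro ballI equalityI subsetI)
    fix H x assume H: "H \<in> F"
    { assume "x \<in> q H ` carrier (obj ?M H)"
      then show "x \<in> carrier (obj P H)"
        using orbit_module_hom_D(3)[OF q H] by auto }
    assume x: "x \<in> carrier (obj P H)"
    let ?b = "(\<lambda>c\<in>lcosets\<^bsub>G\<^esub> H. c, H, x)"
    have b: "?b \<in> cover_basis G F P H"
      using H x orbit_hom_id[OF G(1)] G(2) by (simp add: cover_basis_def subgroup_family_def)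
    have "q H (frag_of ?b) = x"
      using q_of[OF H b] Pm H x by (simp add: orbit_module_def)
    moreover have "frag_of ?b \<in> carrier (obj ?M H)"
      using b H by (simp add: cov.obj_M)
    ultimately show "x \<in> q H ` carrier (obj ?M H)" by force
  qed
  moreover define i where "i = (\<lambda>H\<in>F. \<lambda>x\<in>carrier (obj P H). x)"
  have "i \<in> orbit_module_hom G F P P"
    by (rule orbit_module_hom_I)
      (auto simp: i_def hom_def orbit_module_arr_closed[OF Pm] monoid.m_closed[OF orbit_module_monoid[OF Pm]])
  ultimately obtain s where s: "s \<in> orbit_module_hom G F P ?M" and qs: "orbit_module_comp F P q s = i"
    using P cov.module Pm q unfolding orbit_projective_def by metis
  obtain h where h: "h \<in> orbit_module_hom G F ?M A"
    and \<pi>h: "orbit_module_comp F ?M \<pi> h = orbit_module_comp F ?M \<eta> q"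
    using cov.lift[OF A C \<pi> epi orbit_module_comp_hom[OF cov.module q \<eta>]] by blast
  have scl: "s H x \<in> carrier (obj ?M H)" if "H \<in> F" "x \<in> carrier (obj P H)" for H x
    using orbit_module_hom_D(3)[OF s that] .
  have "orbit_module_comp F P h s \<in> orbit_module_hom G F P A"
    by (rule orbit_module_comp_hom[OF Pm s h])
  moreover have "orbit_module_comp F P \<pi> (orbit_module_comp F P h s) = \<eta>"
  proof (intro ext)
    fix H x
    consider "H \<notin> F" | "H \<in> F" "x \<notin> carrier (obj P H)" | "H \<in> F" "x \<in> carrier (obj P H)" by blast
    then show "orbit_module_comp F P \<pi> (orbit_module_comp F P h s) H x = \<eta> H x"
    proof cases
      case 1
      then show ?thesis using \<eta> by (simp add: orbit_module_comp_def orbit_module_hom_def PiE_iff extensional_def)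
    next
      case 2
      then show ?thesis using orbit_module_hom_D(2)[OF \<eta>]
        by (simp add: orbit_module_comp_def compose_def extensional_def)
    next
      case 3
      have "\<pi> H (h H (s H x)) = \<eta> H (q H (s H x))"
        using fun_cong[OF fun_cong[OF \<pi>h], of H "s H x"] 3 scl
        by (simp add: orbit_module_comp_def compose_def)
      also have "q H (s H x) = x"
        using fun_cong[OF fun_cong[OF qs], of H x] 3
        by (simp add: orbit_module_comp_def compose_def i_def)
      finally show ?thesis using 3 by (simp add: orbit_module_comp_def compose_def)
    qed
  qed
  ultimately show ?thesis by blast
qed


section \<open>A projective resolution of the constant functor\<close>

text \<open>
  The bar resolution: \<open>bar_module G F n\<close> is free at \<open>G/L\<close> on the chains
  \<open>G/L \<rightarrow> G/H\<^sub>0 \<rightarrow> \<dots> \<rightarrow> G/H\<^sub>n\<close>, each arrow being listed with its target. The recursion for the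
  boundary \<open>bar_bd\<close> extends to the empty chain, which spans the augmentation.
\<close>

fun orbit_chain ::
    "('g, 'm) monoid_scheme \<Rightarrow> 'g set set \<Rightarrow> 'g set \<Rightarrow> (('g set \<Rightarrow> 'g set) \<times> 'g set) list \<Rightarrow> bool" where
  "orbit_chain G F L [] = True"
| "orbit_chain G F L ((\<phi>, H) # cs) = (H \<in> F \<and> \<phi> \<in> orbit_hom G L H \<and> orbit_chain G F H cs)"

fun bar_act ::
    "('g, 'm) monoid_scheme \<Rightarrow> 'g set \<Rightarrow> ('g set \<Rightarrow> 'g set) \<Rightarrow> (('g set \<Rightarrow> 'g set) \<times> 'g set) list
      \<Rightarrow> (('g set \<Rightarrow> 'g set) \<times> 'g set) list" where
  "bar_act G L \<psi> [] = []"
| "bar_act G L \<psi> ((\<phi>, H) # cs) = (compose (lcosets\<^bsub>G\<^esub> L) \<phi> \<psi>, H) # cs"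

fun bar_bd ::
    "('g, 'm) monoid_scheme \<Rightarrow> 'g set \<Rightarrow> (('g set \<Rightarrow> 'g set) \<times> 'g set) list
      \<Rightarrow> (('g set \<Rightarrow> 'g set) \<times> 'g set) list \<Rightarrow>\<^sub>0 int" where
  "bar_bd G L [] = 0"
| "bar_bd G L ((\<phi>, H) # cs) =
    frag_of (bar_act G L \<phi> cs) - frag_extend (frag_of \<circ> (#) (\<phi>, H)) (bar_bd G H cs)"

definition bar_basis ::
    "('g, 'm) monoid_scheme \<Rightarrow> 'g set set \<Rightarrow> nat \<Rightarrow> 'g set \<Rightarrow> (('g set \<Rightarrow> 'g set) \<times> 'g set) list set" where
  "bar_basis G F n L = {cs. length cs = Suc n \<and> orbit_chain G F L cs}"

definition bar_module ::
    "('g, 'm) monoid_scheme \<Rightarrow> 'g set set \<Rightarrow> nat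
      \<Rightarrow> ('g, (('g set \<Rightarrow> 'g set) \<times> 'g set) list \<Rightarrow>\<^sub>0 int) orb_mod" where
  "bar_module G F n =
    \<lparr>obj = (\<lambda>L. free_Abelian_group (bar_basis G F n L)),
     arr = (\<lambda>H L \<psi>. frag_extend (frag_of \<circ> bar_act G H \<psi>))\<rparr>"

definition bar_d ::
    "('g, 'm) monoid_scheme \<Rightarrow> 'g set set \<Rightarrow> nat \<Rightarrow> 'g set
      \<Rightarrow> ((('g set \<Rightarrow> 'g set) \<times> 'g set) list \<Rightarrow>\<^sub>0 int) \<Rightarrow> ((('g set \<Rightarrow> 'g set) \<times> 'g set) list \<Rightarrow>\<^sub>0 int)" where
  "bar_d G F n =
    (\<lambda>L\<in>F. \<lambda>c\<in>carrier (obj (bar_module G F (Suc n)) L). frag_extend (bar_bd G L) c)"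

definition bar_augmentation ::
    "('g, 'm) monoid_scheme \<Rightarrow> 'g set set \<Rightarrow> 'g set
      \<Rightarrow> ((('g set \<Rightarrow> 'g set) \<times> 'g set) list \<Rightarrow>\<^sub>0 int) \<Rightarrow> int" where
  "bar_augmentation G F =
    (\<lambda>L\<in>F. \<lambda>c\<in>carrier (obj (bar_module G F 0) L).
      Poly_Mapping.lookup (frag_extend (bar_bd G L) c) [])"

lemma frag_extend_fun_diff:
  "frag_extend (\<lambda>x. f x - g x) c = frag_extend f c - frag_extend g c"
  using subset_UNIV[of "Poly_Mapping.keys c"]
  by (induction c rule: frag_induction) (auto simp: frag_extend_diff)

lemma frag_extend_frag_extend:
  "frag_extend (\<lambda>x. frag_extend f (g x)) c = frag_extend f (frag_extend g c)"
  using subset_UNIV[of "Poly_Mapping.keys c"]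
  by (induction c rule: frag_induction) (auto simp: frag_extend_diff)

lemma orbit_free_bar:
  assumes "group G" "subgroup_family G F"
  shows "orbit_free G F (bar_module G F n) (bar_basis G F n) (bar_act G)
    (\<lambda>cs. snd (hd cs)) (\<lambda>cs. (\<lambda>c\<in>lcosets\<^bsub>G\<^esub> (snd (hd cs)). c, snd (hd cs)) # tl cs) (\<lambda>cs. fst (hd cs))"
  using assms
  by (intro orbit_free.intro)
    (auto simp: bar_module_def bar_basis_def subgroup_family_def orbit_id_comp length_Suc_conv
      intro!: orbit_hom_compose orbit_hom_id)

context
  fixes G :: "('g, 'm) monoid_scheme" and F :: "'g set set"
  assumes G: "group G" and F: "subgroup_family G F"
begin

lemma fam_sub: "H \<in> F \<Longrightarrow> subgroup H G"
  using F by (simp add: subgroup_family_def)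

lemma length_bar_act [simp]: "length (bar_act G L \<psi> cs) = length cs"
  by (cases cs) auto

lemma chain_bar_act:
  assumes "L \<in> F" "\<psi> \<in> orbit_hom G L H" "orbit_chain G F H cs"
  shows "orbit_chain G F L (bar_act G L \<psi> cs)"
  using assms orbit_hom_compose[OF G fam_sub] by (cases cs) auto

lemma bar_act_id: "orbit_chain G F L cs \<Longrightarrow> bar_act G L (\<lambda>c\<in>lcosets\<^bsub>G\<^esub> L. c) cs = cs"
  by (cases cs) (auto simp: orbit_comp_id)

lemma bar_act_act:
  "\<psi> \<in> orbit_hom G L H \<Longrightarrow>
    bar_act G L \<psi> (bar_act G H \<phi> cs) = bar_act G L (compose (lcosets\<^bsub>G\<^esub> L) \<phi> \<psi>) cs"
  by (cases cs) (auto simp: orbit_comp_assoc)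

lemma keys_bar_bd:
  assumes "L \<in> F" "orbit_chain G F L cs"
  shows "Poly_Mapping.keys (bar_bd G L cs) \<subseteq> {c. orbit_chain G F L c \<and> Suc (length c) = length cs}"
  using assms
proof (induction cs arbitrary: L)
  case (Cons a cs)
  obtain \<phi> H where a: "a = (\<phi>, H)" by (cases a)
  have IH: "Poly_Mapping.keys (bar_bd G H cs) \<subseteq> {c. orbit_chain G F H c \<and> Suc (length c) = length cs}"
    using Cons a by auto
  have "Poly_Mapping.keys (frag_extend (frag_of \<circ> (#) (\<phi>, H)) (bar_bd G H cs))
      \<subseteq> (\<Union>x\<in>Poly_Mapping.keys (bar_bd G H cs). {(\<phi>, H) # x})"
    using keys_frag_extend[of "frag_of \<circ> (#) (\<phi>, H)"] by simp
  also have "\<dots> \<subseteq> {c. orbit_chain G F L c \<and> Suc (length c) = length (a # cs)}"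
    using IH Cons.prems a by auto
  finally show ?case
    using keys_diff[of "frag_of (bar_act G L \<phi> cs)"
        "frag_extend (frag_of \<circ> (#) (\<phi>, H)) (bar_bd G H cs)"]
      chain_bar_act[of L \<phi> H cs] Cons.prems a by auto
qed simp

lemma bar_bd_act:
  assumes "\<psi> \<in> orbit_hom G L H" "orbit_chain G F H cs"
  shows "bar_bd G L (bar_act G L \<psi> cs) = frag_extend (frag_of \<circ> bar_act G L \<psi>) (bar_bd G H cs)"
proof (cases cs)
  case (Cons a w)
  obtain \<phi> N where a: "a = (\<phi>, N)" by (cases a)
  have "bar_act G L \<psi> \<circ> (#) (\<phi>, N) = (#) (compose (lcosets\<^bsub>G\<^esub> L) \<phi> \<psi>, N)"
    by auto
  then show ?thesis
    using assms by (simp add: Cons a frag_extend_diff frag_extend_compose bar_act_act o_assoc)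
      (simp add: o_def)
qed simp

lemma bar_bd_bd:
  assumes "L \<in> F" "orbit_chain G F L cs"
  shows "frag_extend (bar_bd G L) (bar_bd G L cs) = 0"
  using assms
proof (induction cs arbitrary: L)
  case (Cons a cs)
  obtain \<phi> H where a: "a = (\<phi>, H)" by (cases a)
  have "frag_extend (bar_bd G L) (frag_extend (frag_of \<circ> (#) (\<phi>, H)) (bar_bd G H cs))
      = frag_extend (\<lambda>v. (frag_of \<circ> bar_act G L \<phi>) v
          - frag_extend (frag_of \<circ> (#) (\<phi>, H)) (bar_bd G H v)) (bar_bd G H cs)"
    by (simp add: o_def flip: frag_extend_frag_extend)
  also have "\<dots> = frag_extend (frag_of \<circ> bar_act G L \<phi>) (bar_bd G H cs)
      - frag_extend (frag_of \<circ> (#) (\<phi>, H)) (frag_extend (bar_bd G H) (bar_bd G H cs))"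
    by (simp only: frag_extend_fun_diff frag_extend_frag_extend)
  also have "\<dots> = bar_bd G L (bar_act G L \<phi> cs)"
    using Cons a by (simp add: bar_bd_act[of \<phi> L H])
  finally show ?case by (simp add: a frag_extend_diff)
qed simp

lemma bar_homotopy:
  assumes "Poly_Mapping.keys c \<subseteq> {cs. orbit_chain G F L cs}"
  shows "frag_extend (bar_bd G L) (frag_extend (frag_of \<circ> (#) (\<lambda>c\<in>lcosets\<^bsub>G\<^esub> L. c, L)) c)
    = c - frag_extend (frag_of \<circ> (#) (\<lambda>c\<in>lcosets\<^bsub>G\<^esub> L. c, L)) (frag_extend (bar_bd G L) c)"
  using assms
proof (induction c rule: frag_induction)
  case (one x)
  then have "bar_act G L (\<lambda>c\<in>lcosets\<^bsub>G\<^esub> L. c) x = x" by (simp only: mem_Collect_eq bar_act_id)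
  then show ?case by (simp only: frag_extend_of bar_bd.simps o_def)
qed (simp_all add: frag_extend_diff)

lemma obj_bar: "obj (bar_module G F n) L = free_Abelian_group (bar_basis G F n L)"
  by (simp add: bar_module_def)

lemma bd_closed:
  assumes "L \<in> F" "Poly_Mapping.keys c \<subseteq> bar_basis G F (Suc n) L"
  shows "Poly_Mapping.keys (frag_extend (bar_bd G L) c) \<subseteq> bar_basis G F n L"
  using keys_frag_extend[of "bar_bd G L" c] keys_bar_bd[OF assms(1)] assms(2)
  by (fastforce simp: bar_basis_def)

lemma bd_closed_0:
  assumes "L \<in> F" "Poly_Mapping.keys c \<subseteq> bar_basis G F 0 L"
  shows "Poly_Mapping.keys (frag_extend (bar_bd G L) c) \<subseteq> {[]}"
  using keys_frag_extend[of "bar_bd G L" c] keys_bar_bd[OF assms(1)] assms(2)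
  by (fastforce simp: bar_basis_def)

lemma bd_nat:
  assumes "\<psi> \<in> orbit_hom G L H" "Poly_Mapping.keys c \<subseteq> {cs. orbit_chain G F H cs}"
  shows "frag_extend (bar_bd G L) (frag_extend (frag_of \<circ> bar_act G L \<psi>) c)
    = frag_extend (frag_of \<circ> bar_act G L \<psi>) (frag_extend (bar_bd G H) c)"
  using assms(2)
proof (induction c rule: frag_induction)
  case (one x)
  then have "bar_bd G L (bar_act G L \<psi> x) = frag_extend (frag_of \<circ> bar_act G L \<psi>) (bar_bd G H x)"
    by (simp only: mem_Collect_eq bar_bd_act[OF assms(1)])
  then show ?case by (simp only: frag_extend_of o_def)
qed (simp_all add: frag_extend_diff)

lemma bd_exact:
  assumes "L \<in> F"
  shows "frag_extend (bar_bd G L) ` {c. Poly_Mapping.keys c \<subseteq> bar_basis G F (Suc n) L}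
    = {c. Poly_Mapping.keys c \<subseteq> bar_basis G F n L \<and> frag_extend (bar_bd G L) c = 0}"
proof (intro equalityI subsetI)
  fix x assume "x \<in> frag_extend (bar_bd G L) ` {c. Poly_Mapping.keys c \<subseteq> bar_basis G F (Suc n) L}"
  then obtain c where c: "Poly_Mapping.keys c \<subseteq> bar_basis G F (Suc n) L" "x = frag_extend (bar_bd G L) c"
    by blast
  have "frag_extend (bar_bd G L) x = 0"
    unfolding c(2) frag_extend_frag_extend[symmetric]
    by (rule frag_extend_eq_0) (use c(1) bar_bd_bd[OF assms] in \<open>auto simp: bar_basis_def\<close>)
  then show "x \<in> {c. Poly_Mapping.keys c \<subseteq> bar_basis G F n L \<and> frag_extend (bar_bd G L) c = 0}"
    using bd_closed[OF assms c(1)] c(2) by simp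
next
  fix c assume "c \<in> {c. Poly_Mapping.keys c \<subseteq> bar_basis G F n L \<and> frag_extend (bar_bd G L) c = 0}"
  then have k: "Poly_Mapping.keys c \<subseteq> bar_basis G F n L" and z: "frag_extend (bar_bd G L) c = 0"
    by auto
  let ?s = "frag_extend (frag_of \<circ> (#) (\<lambda>c\<in>lcosets\<^bsub>G\<^esub> L. c, L)) c"
  have "frag_extend (bar_bd G L) ?s = c"
    using bar_homotopy[of c L] k z by (auto simp: bar_basis_def)
  moreover have "Poly_Mapping.keys ?s \<subseteq> bar_basis G F (Suc n) L"
  proof
    fix x assume "x \<in> Poly_Mapping.keys ?s"
    then obtain y where "y \<in> Poly_Mapping.keys c" "x = (\<lambda>c\<in>lcosets\<^bsub>G\<^esub> L. c, L) # y"
      using keys_frag_extend[of "frag_of \<circ> (#) (\<lambda>c\<in>lcosets\<^bsub>G\<^esub> L. c, L)" c] by (auto simp del: restrict_apply)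
    then show "x \<in> bar_basis G F (Suc n) L"
      using k assms orbit_hom_id[OF G fam_sub[OF assms]] by (simp add: bar_basis_def subset_iff)
  qed
  ultimately show "c \<in> frag_extend (bar_bd G L) ` {c. Poly_Mapping.keys c \<subseteq> bar_basis G F (Suc n) L}"
    by (intro image_eqI[where x = ?s]) simp_all
qed

theorem bar_resolution:
  "projective_resolution G F (constant_module integer_group)
    (bar_module G F) (bar_d G F) (bar_augmentation G F)"
proof -
  have arr_bar: "arr (bar_module G F n) H L \<psi> = frag_extend (frag_of \<circ> bar_act G H \<psi>)" for n H L \<psi>
    by (simp add: bar_module_def)
  have chain: "Poly_Mapping.keys c \<subseteq> bar_basis G F n L \<Longrightarrow> Poly_Mapping.keys c \<subseteq> {cs. orbit_chain G F L cs}"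
    for c n L by (auto simp: bar_basis_def)
  have act: "Poly_Mapping.keys (frag_extend (frag_of \<circ> bar_act G H \<psi>) c) \<subseteq> bar_basis G F n H"
    if "H \<in> F" "L \<in> F" "\<psi> \<in> orbit_hom G H L" "Poly_Mapping.keys c \<subseteq> bar_basis G F n L" for H L \<psi> c n
    using orbit_free.arr_keys[OF orbit_free_bar[OF G F] that] by (simp add: arr_bar)
  have d: "bar_d G F n \<in> orbit_module_hom G F (bar_module G F (Suc n)) (bar_module G F n)" for n
  proof (rule orbit_module_hom_I)
    fix H assume H: "H \<in> F"
    show "bar_d G F n H \<in> hom (obj (bar_module G F (Suc n)) H) (obj (bar_module G F n) H)"
      using bd_closed[OF H] H monoid.m_closed[OF group.is_monoid[OF group_free_Abelian_group]]
      by (intro homI) (auto simp: bar_d_def obj_bar frag_extend_add dest: subsetD[OF keys_add])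
    show "bar_d G F n H \<in> extensional (carrier (obj (bar_module G F (Suc n)) H))"
      using H by (simp add: bar_d_def)
  next
    show "bar_d G F n \<in> extensional F" by (simp add: bar_d_def)
  next
    fix H L \<phi> a
    assume *: "H \<in> F" "L \<in> F" "\<phi> \<in> orbit_hom G H L" "a \<in> carrier (obj (bar_module G F (Suc n)) L)"
    then show "bar_d G F n H (arr (bar_module G F (Suc n)) H L \<phi> a) = arr (bar_module G F n) H L \<phi> (bar_d G F n L a)"
      using act[OF *(1-3)] bd_nat[OF *(3) chain] by (simp add: bar_d_def obj_bar arr_bar)
  qed
  have e: "bar_augmentation G F \<in> orbit_module_hom G F (bar_module G F 0) (constant_module integer_group)"
  proof (rule orbit_module_hom_I)
    fix H assume H: "H \<in> F"
    show "bar_augmentation G F H \<in> hom (obj (bar_module G F 0) H) (obj (constant_module integer_group) H)"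
      using H by (intro homI)
        (auto simp: bar_augmentation_def obj_bar frag_extend_add lookup_add constant_module_def integer_group_def
          dest: subsetD[OF keys_add])
    show "bar_augmentation G F H \<in> extensional (carrier (obj (bar_module G F 0) H))"
      using H by (simp add: bar_augmentation_def)
  next
    show "bar_augmentation G F \<in> extensional F" by (simp add: bar_augmentation_def)
  next
    fix H L \<phi> a
    assume *: "H \<in> F" "L \<in> F" "\<phi> \<in> orbit_hom G H L" "a \<in> carrier (obj (bar_module G F 0) L)"
    have k: "Poly_Mapping.keys a \<subseteq> bar_basis G F 0 L" using * by (simp add: obj_bar)
    have "frag_extend (bar_bd G H) (frag_extend (frag_of \<circ> bar_act G H \<phi>) a)
        = frag_extend (frag_of \<circ> bar_act G H \<phi>) (frag_extend (bar_bd G L) a)"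
      by (rule bd_nat[OF *(3) chain[OF k]])
    also have "\<dots> = frag_extend frag_of (frag_extend (bar_bd G L) a)"
      by (rule frag_extend_eq) (use bd_closed_0[OF *(2) k] in auto)
    also have "\<dots> = frag_extend (bar_bd G L) a" by (simp flip: frag_expansion)
    finally show "bar_augmentation G F H (arr (bar_module G F 0) H L \<phi> a)
        = arr (constant_module integer_group) H L \<phi> (bar_augmentation G F L a)"
      using * act[OF *(1-3) k] by (simp add: bar_augmentation_def obj_bar arr_bar constant_module_def)
  qed
  have epi: "orbit_module_epi F (bar_module G F 0) (constant_module integer_group) (bar_augmentation G F)"
    unfolding orbit_module_epi_def
  proof
    fix H assume H: "H \<in> F"
    have "k \<in> bar_augmentation G F H ` carrier (obj (bar_module G F 0) H)" for k
    proof (rule image_eqI)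
      let ?c = "frag_cmul k (frag_of [(\<lambda>c\<in>lcosets\<^bsub>G\<^esub> H. c, H)])"
      show c: "?c \<in> carrier (obj (bar_module G F 0) H)"
        using H orbit_hom_id[OF G fam_sub[OF H]] by (simp add: obj_bar bar_basis_def subset_iff)
      show "k = bar_augmentation G F H ?c"
        using H c by (simp add: bar_augmentation_def frag_extend_cmul)
    qed
    then show "bar_augmentation G F H ` carrier (obj (bar_module G F 0) H)
        = carrier (obj (constant_module integer_group) H)"
      by (auto simp: constant_module_def integer_group_def)
  qed
  have "bar_d G F 0 H ` carrier (obj (bar_module G F 1) H)
      = kernel (obj (bar_module G F 0) H) (obj (constant_module integer_group) H) (bar_augmentation G F H)"
    if H: "H \<in> F" for H
  proof -
    have z: "Poly_Mapping.lookup (frag_extend (bar_bd G H) c) [] = 0 \<longleftrightarrow> frag_extend (bar_bd G H) c = 0"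
      if "Poly_Mapping.keys c \<subseteq> bar_basis G F 0 H" for c
      using bd_closed_0[OF H that] by (metis in_keys_iff keys_eq_empty lookup_zero subset_singletonD singletonI)
    have "bar_d G F 0 H ` carrier (obj (bar_module G F 1) H)
        = frag_extend (bar_bd G H) ` {c. Poly_Mapping.keys c \<subseteq> bar_basis G F (Suc 0) H}"
      using H by (intro image_cong) (auto simp: bar_d_def obj_bar)
    also have "\<dots> = kernel (obj (bar_module G F 0) H) (obj (constant_module integer_group) H) (bar_augmentation G F H)"
      unfolding bd_exact[OF H] using H z
      by (auto simp: kernel_def obj_bar bar_augmentation_def constant_module_def integer_group_def)
    finally show ?thesis .
  qed
  moreover have "bar_d G F (Suc n) H ` carrier (obj (bar_module G F (Suc (Suc n))) H)
      = kernel (obj (bar_module G F (Suc n)) H) (obj (bar_module G F n) H) (bar_d G F n H)"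
    if H: "H \<in> F" for H n
  proof -
    have "bar_d G F (Suc n) H ` carrier (obj (bar_module G F (Suc (Suc n))) H)
        = frag_extend (bar_bd G H) ` {c. Poly_Mapping.keys c \<subseteq> bar_basis G F (Suc (Suc n)) H}"
      using H by (intro image_cong) (auto simp: bar_d_def obj_bar)
    also have "\<dots> = kernel (obj (bar_module G F (Suc n)) H) (obj (bar_module G F n) H) (bar_d G F n H)"
      unfolding bd_exact[OF H] using H by (auto simp: kernel_def obj_bar bar_d_def)
    finally show ?thesis .
  qed
  ultimately show ?thesis
    unfolding projective_resolution_def
    using d e epi orbit_free.projective[OF orbit_free_bar[OF G F]] by simp
qed

end

end

theory Submission
  imports Defs
begin

text \<open>
  A module map out of a resolution \<open>P\<close> into the fixed point functor is controlled by its value at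
  \<open>G/1\<close>, since the maps \<open>G/1 \<rightarrow> G/H\<close> induce the inclusions \<open>A\<^sup>H \<subseteq> A\<close>. A 1-cocycle gives there an
  equivariant map on \<open>ker(\<epsilon> : P\<^sub>0(G/1) \<rightarrow> \<int>)\<close>, and the obstruction to extending it to \<open>P\<^sub>0(G/1)\<close> is a
  crossed homomorphism \<open>G \<rightarrow> A\<close>. For \<open>A = E\<^sup>\<times>\<close> it is principal by Hilbert's Theorem 90.
\<close>


section \<open>Hilbert's Theorem 90\<close>

text \<open>The fixed point functor is coinduced from \<open>G/1\<close>: an equivariant map
  \<open>M(G/1) \<rightarrow> A\<close> always extends to a module map out of \<open>M\<close>,
  because the image of \<open>M(G/H)\<close> in \<open>M(G/1)\<close> is fixed by \<open>H\<close>
  and is therefore sent to elements fixed by \<open>H\<close>. Exactness is objectwise, so it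
  survives evaluation at \<open>G/1\<close>, an object because the family contains the trivial
  subgroup. The problem becomes one about ordinary \<open>G\<close>-modules, where the obstacle is
  equivariance alone: the augmentation onto \<int> splits as a map of abelian groups by any
  \<open>p\<close> of augmentation 1, but \<open>p\<close> need not be invariant. The crossed
  homomorphism records this failure, and writing it as a coboundary tells which value
  \<open>b\<close> to assign to \<open>p\<close>.\<close>

text \<open>Dedekind's argument: the relation at \<open>y \<otimes> x\<close> minus
  \<open>\<tau> y\<close> times the relation at \<open>x\<close> has no term for
  \<open>\<tau>\<close>, which leaves a relation on \<open>T\<close> with coefficients
  \<open>c \<sigma> \<otimes> (\<sigma> y \<ominus> \<tau> y)\<close>. A monoid as domain lets field
  automorphisms be characters of all of \<open>E\<close>, zero included; the condition at the unit
  excludes the zero map, which is multiplicative too.\<close>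

lemma (in domain) independent_characters:
  assumes "monoid M" "finite S"
    and "S \<subseteq> hom M R \<inter> extensional (carrier M)" "\<And>\<chi>. \<chi> \<in> S \<Longrightarrow> \<chi> \<one>\<^bsub>M\<^esub> = \<one>"
    and "c \<in> S \<rightarrow> carrier R"
    and "\<And>x. x \<in> carrier M \<Longrightarrow> (\<Oplus>\<chi>\<in>S. c \<chi> \<otimes> \<chi> x) = \<zero>"
    and "\<chi> \<in> S"
  shows "c \<chi> = \<zero>"
  using assms(2-)
proof (induction S arbitrary: c \<chi> rule: finite_induct)
  case (insert \<tau> T)
  interpret M: monoid M by fact
  have cl: "\<And>\<sigma> x. \<sigma> \<in> insert \<tau> T \<Longrightarrow> x \<in> carrier M \<Longrightarrow> \<sigma> x \<in> carrier R"
    and ml: "\<And>\<sigma> x y. \<sigma> \<in> insert \<tau> T \<Longrightarrow> x \<in> carrier M \<Longrightarrow> y \<in> carrier M \<Longrightarrow> \<sigma> (x \<otimes>\<^bsub>M\<^esub> y) = \<sigma> x \<otimes> \<sigma> y"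
    using insert.prems(1) by (auto simp: hom_def)
  have c: "\<And>\<sigma>. \<sigma> \<in> insert \<tau> T \<Longrightarrow> c \<sigma> \<in> carrier R"
    using insert.prems(3) by auto
  have sum: "c \<tau> \<otimes> \<tau> x \<oplus> (\<Oplus>\<sigma>\<in>T. c \<sigma> \<otimes> \<sigma> x) = \<zero>" if "x \<in> carrier M" for x
    using insert.prems(4)[OF that] insert.hyps cl c that by (simp add: Pi_iff)
  have T: "c \<sigma> = \<zero>" if \<sigma>: "\<sigma> \<in> T" for \<sigma>
  proof -
    have "\<sigma> \<noteq> \<tau>" using \<sigma> insert.hyps by auto
    moreover have "\<sigma> \<in> extensional (carrier M)" "\<tau> \<in> extensional (carrier M)"
      using insert.prems(1) \<sigma> by auto
    ultimately obtain y where y: "y \<in> carrier M" "\<sigma> y \<noteq> \<tau> y"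
      by (meson extensionalityI)
    have "c \<sigma> \<otimes> (\<sigma> y \<ominus> \<tau> y) = \<zero>"
    proof (rule insert.IH[of "\<lambda>\<sigma>. c \<sigma> \<otimes> (\<sigma> y \<ominus> \<tau> y)" \<sigma>])
      fix x assume x: "x \<in> carrier M"
      let ?s = "\<Oplus>\<sigma>\<in>T. c \<sigma> \<otimes> \<sigma> x"
      have s: "?s \<in> carrier R" using cl c x by (auto intro!: finsum_closed)
      have "(\<Oplus>\<sigma>\<in>T. c \<sigma> \<otimes> (\<sigma> y \<ominus> \<tau> y) \<otimes> \<sigma> x)
          = (\<Oplus>\<sigma>\<in>T. c \<sigma> \<otimes> \<sigma> (y \<otimes>\<^bsub>M\<^esub> x) \<oplus> (\<ominus> \<tau> y) \<otimes> (c \<sigma> \<otimes> \<sigma> x))"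
      proof (intro finsum_cong' refl)
        fix \<sigma> assume "\<sigma> \<in> T"
        then have *: "c \<sigma> \<in> carrier R" "\<sigma> x \<in> carrier R" "\<sigma> y \<in> carrier R" "\<tau> y \<in> carrier R"
            "\<sigma> (y \<otimes>\<^bsub>M\<^esub> x) = \<sigma> y \<otimes> \<sigma> x"
          using cl c x y ml by auto
        show "c \<sigma> \<otimes> (\<sigma> y \<ominus> \<tau> y) \<otimes> \<sigma> x = c \<sigma> \<otimes> \<sigma> (y \<otimes>\<^bsub>M\<^esub> x) \<oplus> (\<ominus> \<tau> y) \<otimes> (c \<sigma> \<otimes> \<sigma> x)"
          unfolding *(5) using *(1-4) by algebra
      qed (use cl c x y in auto)
      also have "\<dots> = (\<Oplus>\<sigma>\<in>T. c \<sigma> \<otimes> \<sigma> (y \<otimes>\<^bsub>M\<^esub> x)) \<oplus> (\<ominus> \<tau> y) \<otimes> ?s"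
        using cl c x y insert.hyps by (subst finsum_addf) (auto simp: finsum_rdistr)
      also have "(\<Oplus>\<sigma>\<in>T. c \<sigma> \<otimes> \<sigma> (y \<otimes>\<^bsub>M\<^esub> x)) = (\<ominus> \<tau> y) \<otimes> (c \<tau> \<otimes> \<tau> x)"
      proof -
        have "c \<tau> \<otimes> (\<tau> y \<otimes> \<tau> x) \<oplus> (\<Oplus>\<sigma>\<in>T. c \<sigma> \<otimes> \<sigma> (y \<otimes>\<^bsub>M\<^esub> x)) = \<zero>"
          using sum[of "y \<otimes>\<^bsub>M\<^esub> x"] x y ml[of \<tau> y x] by simp
        moreover have "(\<Oplus>\<sigma>\<in>T. c \<sigma> \<otimes> \<sigma> (y \<otimes>\<^bsub>M\<^esub> x)) \<in> carrier R"
          using cl c x y by (auto intro!: finsum_closed)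
        moreover have *: "c \<tau> \<in> carrier R" "\<tau> x \<in> carrier R" "\<tau> y \<in> carrier R"
          using c cl x y by auto
        ultimately have eq: "(\<Oplus>\<sigma>\<in>T. c \<sigma> \<otimes> \<sigma> (y \<otimes>\<^bsub>M\<^esub> x)) = \<ominus> (c \<tau> \<otimes> (\<tau> y \<otimes> \<tau> x))"
          by (intro sum_zero_eq_neg) (simp_all add: a_comm)
        show ?thesis unfolding eq using * by algebra
      qed
      also have "(\<ominus> \<tau> y) \<otimes> (c \<tau> \<otimes> \<tau> x) \<oplus> (\<ominus> \<tau> y) \<otimes> ?s = (\<ominus> \<tau> y) \<otimes> (c \<tau> \<otimes> \<tau> x \<oplus> ?s)"
        using s c cl x y by (simp add: r_distr)
      also have "\<dots> = \<zero>"
        using sum[OF x] cl y by simp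
      finally show "(\<Oplus>\<sigma>\<in>T. c \<sigma> \<otimes> (\<sigma> y \<ominus> \<tau> y) \<otimes> \<sigma> x) = \<zero>" .
    next
      show "\<chi> \<one>\<^bsub>M\<^esub> = \<one>" if "\<chi> \<in> T" for \<chi>
        using insert.prems(2)[of \<chi>] that by simp
    qed (use insert.prems(1) \<sigma> cl c y in auto)
    moreover have "\<sigma> y \<ominus> \<tau> y \<noteq> \<zero>"
      using y \<sigma> cl by simp
    moreover have "\<sigma> y \<ominus> \<tau> y \<in> carrier R" "c \<sigma> \<in> carrier R"
      using y \<sigma> cl c by auto
    ultimately show ?thesis
      using integral by blast
  qed
  \<comment> \<open>Only the coefficient of \<open>\<tau>\<close> is left, and the unit is a point
    where \<open>\<tau>\<close> is known not to vanish.\<close>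
  have "(\<Oplus>\<sigma>\<in>T. c \<sigma> \<otimes> \<sigma> \<one>\<^bsub>M\<^esub>) = (\<Oplus>\<sigma>\<in>T. \<zero>)"
    using cl by (intro finsum_cong') (auto simp: T)
  then have "c \<tau> = \<zero>"
    using sum[OF M.one_closed] insert.prems(2)[of \<tau>] c[of \<tau>] by (simp add: finsum_zero)
  then show ?case using T insert.prems(5) by auto
qed simp

section \<open>The Galois group as a finite group of bijections\<close>

lemma galois_group_carrier:
  "\<sigma> \<in> carrier (galois_group E K) \<longleftrightarrow>
    \<sigma> \<in> Bij (carrier E) \<and> \<sigma> \<in> ring_iso E E \<and> (\<forall>a\<in>K. \<sigma> a = a)"
  by (auto simp: galois_group_def)

lemma galois_group_mult:
  "\<lbrakk>\<sigma> \<in> carrier (galois_group E K); \<tau> \<in> carrier (galois_group E K)\<rbrakk> \<Longrightarrow>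
    \<sigma> \<otimes>\<^bsub>galois_group E K\<^esub> \<tau> = compose (carrier E) \<sigma> \<tau>"
  by (simp add: galois_group_def BijGroup_def)

lemma galois_group_one: "\<one>\<^bsub>galois_group E K\<^esub> = (\<lambda>x\<in>carrier E. x)"
  by (simp add: galois_group_def BijGroup_def)

text \<open>Elements of \<open>BijGroup\<close> are extensional, so identity, composites and
  inverses of automorphisms are cut off outside the carrier; \<open>ring_iso_restrict\<close>
  carries the isomorphism property over to the truncated maps.\<close>

lemma group_galois_group:
  assumes "ring E" "K \<subseteq> carrier E"
  shows "group (galois_group E K)"
proof -
  interpret ring E by fact
  let ?S = "{\<sigma> \<in> Bij (carrier E). \<sigma> \<in> ring_iso E E \<and> (\<forall>a\<in>K. \<sigma> a = a)}"
  have "subgroup ?S (BijGroup (carrier E))"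
  proof (rule group.subgroupI[OF group_BijGroup])
    show "?S \<subseteq> carrier (BijGroup (carrier E))" by (auto simp: BijGroup_def)
    have "(\<lambda>x\<in>carrier E. x) \<in> ?S"
      using assms(2) id_Bij ring_iso_restrict[OF ring_iso_set_refl, of "\<lambda>x\<in>carrier E. x"] by auto
    then show "?S \<noteq> {}" by blast
  next
    fix \<sigma> assume \<sigma>: "\<sigma> \<in> ?S"
    then have inv: "inv\<^bsub>BijGroup (carrier E)\<^esub> \<sigma> = (\<lambda>x\<in>carrier E. inv_into (carrier E) \<sigma> x)"
      by (simp add: inv_BijGroup)
    have "inv_into (carrier E) \<sigma> a = a" if "a \<in> K" for a
      using \<sigma> that assms(2) by (auto simp: Bij_def bij_betw_def intro!: inv_into_f_eq)
    moreover have "(\<lambda>x\<in>carrier E. inv_into (carrier E) \<sigma> x) \<in> ring_iso E E"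
      using \<sigma> ring_iso_restrict[OF ring_iso_set_sym[OF ring_axioms]] by auto
    ultimately show "inv\<^bsub>BijGroup (carrier E)\<^esub> \<sigma> \<in> ?S"
      unfolding inv using \<sigma> assms(2) restrict_inv_into_Bij by auto
  next
    fix \<sigma> \<tau> assume *: "\<sigma> \<in> ?S" "\<tau> \<in> ?S"
    then have "compose (carrier E) \<sigma> \<tau> \<in> ring_iso E E"
      using ring_iso_restrict[OF ring_iso_set_trans[of \<tau> E E \<sigma> E], of "compose (carrier E) \<sigma> \<tau>"]
      by (auto simp: compose_def)
    with * show "\<sigma> \<otimes>\<^bsub>BijGroup (carrier E)\<^esub> \<tau> \<in> ?S"
      using assms(2) by (auto simp: BijGroup_def compose_Bij compose_eq)
  qed
  then show ?thesis
    unfolding galois_group_def by (rule group.subgroup_imp_group[OF group_BijGroup])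
qed

text \<open>An automorphism is determined by its values on a basis, which are roots of minimal polynomials.\<close>

lemma finite_galois_group:
  assumes "finite_galois_extension E K"
  shows "finite (carrier (galois_group E K))"
proof -
  interpret field E using assms by (simp add: finite_galois_extension_def)
  have K: "subfield K E" and fd: "finite_dimension K (carrier E)"
    using assms by (auto simp: finite_galois_extension_def)
  obtain n where "dimension n K (carrier E)" using fd by blast
  from exists_base[OF K this] obtain Vs where Vs: "set Vs \<subseteq> carrier E" "Span K Vs = carrier E"
    by blast
  have KE: "K \<subseteq> carrier E" using subfieldE(3)[OF K] .
  have aut: "ring_hom_ring E E \<sigma>" if "\<sigma> \<in> carrier (galois_group E K)" for \<sigma>
    using that ring_axioms
    by (auto simp: galois_group_carrier ring_iso_def intro!: ring_hom_ringI2)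
  define Z where "Z v = {x. is_root (Irr K v) x}" for v
  have Z: "finite (Z v) \<and> (\<forall>\<sigma>\<in>carrier (galois_group E K). \<sigma> v \<in> Z v)" if "v \<in> carrier E" for v
  proof -
    have alg: "(algebraic over K) v"
      by (rule finite_dimension_imp_algebraic[OF K carrier_is_subring fd that])
    note I = IrrE[OF K that alg]
    have p: "Irr K v \<in> carrier (poly_ring E)" "set (Irr K v) \<subseteq> K" "Irr K v \<noteq> []"
      using I(1) KE carrier_polynomial_shell[OF subfieldE(1)[OF K]] pirreducibleE(1)[OF subfieldE(1)[OF K] I(1,2)]
      by (auto simp: univ_poly_def polynomial_def)
    have "\<sigma> v \<in> Z v" if \<sigma>: "\<sigma> \<in> carrier (galois_group E K)" for \<sigma>
    proof -
      interpret \<sigma>: ring_hom_ring E E \<sigma> by (rule aut[OF \<sigma>])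
      \<comment> \<open>The coefficients lie in \<open>K\<close>, so \<open>\<sigma>\<close> takes
        the value of the polynomial at \<open>v\<close> to its value at
        \<open>\<sigma> v\<close>.\<close>
      have "map \<sigma> (Irr K v) = Irr K v"
        using p(2) \<sigma> by (intro map_idI) (auto simp: galois_group_carrier)
      then show ?thesis
        using \<sigma>.eval_hom'[OF \<open>v \<in> carrier E\<close>, of "Irr K v"] p KE I(4) \<open>v \<in> carrier E\<close>
        by (auto simp: Z_def is_root_def)
    qed
    then show ?thesis using finite_number_of_roots[OF p(1)] by (simp add: Z_def)
  qed
  have inj: "inj_on (\<lambda>\<sigma>. restrict \<sigma> (set Vs)) (carrier (galois_group E K))"
  proof (rule inj_onI)
    fix \<sigma> \<tau> assume *: "\<sigma> \<in> carrier (galois_group E K)" "\<tau> \<in> carrier (galois_group E K)"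
      and r: "restrict \<sigma> (set Vs) = restrict \<tau> (set Vs)"
    interpret \<sigma>: ring_hom_ring E E \<sigma> by (rule aut[OF *(1)])
    interpret \<tau>: ring_hom_ring E E \<tau> by (rule aut[OF *(2)])
    \<comment> \<open>Both maps fix the scalars, so agreement on the spanning list \<open>Vs\<close>
      passes to all of \<open>E\<close>.\<close>
    have comb: "\<sigma> (combine Ks Us) = \<tau> (combine Ks Us)" if "set Ks \<subseteq> K" "set Us \<subseteq> set Vs" for Ks Us
      using that
    proof (induction Ks Us rule: combine.induct)
      case (1 k Ks u Us)
      have "\<sigma> u = \<tau> u" using 1(3) fun_cong[OF r, of u] by simp
      moreover have "\<sigma> k = k" "\<tau> k = k" "k \<in> carrier E" "u \<in> carrier E"
        using 1(2,3) * KE Vs(1) by (auto simp: galois_group_carrier)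
      moreover have "combine Ks Us \<in> carrier E"
        using 1(2,3) KE Vs(1) by (intro combine_in_carrier) auto
      ultimately show ?case using 1 by simp
    qed simp_all
    have "\<sigma> x = \<tau> x" if "x \<in> carrier E" for x
      using that comb unfolding Vs(2)[symmetric] Span_eq_combine_set[OF K Vs(1)] by blast
    then show "\<sigma> = \<tau>"
      using * by (intro extensionalityI[of _ "carrier E"]) (auto simp: galois_group_carrier Bij_def)
  qed
  have "(\<lambda>\<sigma>. restrict \<sigma> (set Vs)) ` carrier (galois_group E K) \<subseteq> PiE (set Vs) Z"
    using Z Vs(1) by auto
  then have "finite ((\<lambda>\<sigma>. restrict \<sigma> (set Vs)) ` carrier (galois_group E K))"
    by (rule finite_subset) (use Z Vs(1) in \<open>auto intro!: finite_PiE\<close>)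
  then show ?thesis using finite_image_iff[OF inj] by simp
qed

text \<open>
  By independence of characters the resolvent \<open>y = \<Sum>\<^sub>\<sigma> c(\<sigma>) \<sigma>(x)\<close> is nonzero for some \<open>x\<close>, and
  the cocycle identity gives \<open>c(\<tau>) \<tau>(y) = y\<close>.
\<close>

theorem hilbert_90:
  assumes EK: "finite_galois_extension E K"
    and c: "c \<in> carrier (galois_group E K) \<rightarrow> carrier (mult_of E)"
    and cocycle: "\<And>\<sigma> \<tau>. \<lbrakk>\<sigma> \<in> carrier (galois_group E K); \<tau> \<in> carrier (galois_group E K)\<rbrakk> \<Longrightarrow>
      c (\<sigma> \<otimes>\<^bsub>galois_group E K\<^esub> \<tau>) = c \<sigma> \<otimes>\<^bsub>E\<^esub> \<sigma> (c \<tau>)"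
  obtains b where "b \<in> carrier (mult_of E)"
    "\<And>\<sigma>. \<sigma> \<in> carrier (galois_group E K) \<Longrightarrow> \<sigma> b = c \<sigma> \<otimes>\<^bsub>E\<^esub> b"
proof -
  interpret field E using EK by (simp add: finite_galois_extension_def)
  let ?G = "galois_group E K"
  have KE: "K \<subseteq> carrier E" using EK subfieldE(3) by (auto simp: finite_galois_extension_def)
  interpret G: group ?G by (rule group_galois_group[OF ring_axioms KE])
  have fin: "finite (carrier ?G)" by (rule finite_galois_group[OF EK])
  have aut: "\<sigma> \<in> ring_hom E E" "\<sigma> \<in> extensional (carrier E)" if "\<sigma> \<in> carrier ?G" for \<sigma>
    using that by (auto simp: galois_group_carrier ring_iso_def Bij_def)
  have c': "c \<sigma> \<in> carrier E" "c \<sigma> \<noteq> \<zero>\<^bsub>E\<^esub>" if "\<sigma> \<in> carrier ?G" for \<sigma>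
    using c that by auto
  have cl: "\<sigma> x \<in> carrier E" if "\<sigma> \<in> carrier ?G" "x \<in> carrier E" for \<sigma> x
    using ring_hom_closed[OF aut(1)] that by blast
  define y where "y x = (\<Oplus>\<^bsub>E\<^esub>\<sigma>\<in>carrier ?G. c \<sigma> \<otimes>\<^bsub>E\<^esub> \<sigma> x)" for x
  have ycl: "y x \<in> carrier E" if "x \<in> carrier E" for x
    using that c' cl by (auto simp: y_def intro!: finsum_closed)
  obtain x where x: "x \<in> carrier E" "y x \<noteq> \<zero>\<^bsub>E\<^esub>"
  proof (rule ccontr)
    assume "\<not> thesis"
    then have "\<And>x. x \<in> carrier E \<Longrightarrow> y x = \<zero>\<^bsub>E\<^esub>" using that by blast
    \<comment> \<open>A resolvent that vanishes everywhere is a linear relation between distinct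
      characters, with the nonzero values of \<open>c\<close> as coefficients.\<close>
    then have "c \<one>\<^bsub>?G\<^esub> = \<zero>\<^bsub>E\<^esub>"
      using fin aut c'
      by (intro independent_characters[OF monoid_axioms fin, where c = c])
        (auto simp: y_def hom_def ring_hom_one ring_hom_mult cl)
    then show False using c' by blast
  qed
  have yinv: "c \<tau> \<otimes>\<^bsub>E\<^esub> \<tau> (y x) = y x" if \<tau>: "\<tau> \<in> carrier ?G" for \<tau>
  proof -
    interpret \<tau>: ring_hom_cring E E \<tau>
      using aut(1)[OF \<tau>] by (simp add: ring_hom_cring_def ring_hom_cring_axioms_def is_cring)
    have "c \<tau> \<otimes>\<^bsub>E\<^esub> \<tau> (y x) = c \<tau> \<otimes>\<^bsub>E\<^esub> (\<Oplus>\<^bsub>E\<^esub>\<sigma>\<in>carrier ?G. \<tau> (c \<sigma> \<otimes>\<^bsub>E\<^esub> \<sigma> x))"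
      using c' cl x by (simp add: y_def o_def)
    also have "\<dots> = (\<Oplus>\<^bsub>E\<^esub>\<sigma>\<in>carrier ?G. c \<tau> \<otimes>\<^bsub>E\<^esub> \<tau> (c \<sigma> \<otimes>\<^bsub>E\<^esub> \<sigma> x))"
      using fin c' cl x \<tau> by (intro finsum_rdistr) auto
    also have "\<dots> = (\<Oplus>\<^bsub>E\<^esub>\<sigma>\<in>carrier ?G. c (\<tau> \<otimes>\<^bsub>?G\<^esub> \<sigma>) \<otimes>\<^bsub>E\<^esub> (\<tau> \<otimes>\<^bsub>?G\<^esub> \<sigma>) x)"
    proof (intro finsum_cong' refl)
      fix \<sigma> assume \<sigma>: "\<sigma> \<in> carrier ?G"
      have "(\<tau> \<otimes>\<^bsub>?G\<^esub> \<sigma>) x = \<tau> (\<sigma> x)"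
        using \<sigma> \<tau> x by (simp add: galois_group_mult compose_eq)
      then show "c \<tau> \<otimes>\<^bsub>E\<^esub> \<tau> (c \<sigma> \<otimes>\<^bsub>E\<^esub> \<sigma> x) = c (\<tau> \<otimes>\<^bsub>?G\<^esub> \<sigma>) \<otimes>\<^bsub>E\<^esub> (\<tau> \<otimes>\<^bsub>?G\<^esub> \<sigma>) x"
        using \<sigma> \<tau> x c' cl by (simp add: cocycle m_assoc)
    qed (use c' cl x \<tau> in \<open>auto simp del: \<tau>.hom_mult\<close>)
    \<comment> \<open>Left translation by \<open>\<tau>\<close> permutes the group, so the sum is
      the resolvent again.\<close>
    also have "\<dots> = (\<Oplus>\<^bsub>E\<^esub>\<sigma>\<in>(\<lambda>\<sigma>. \<tau> \<otimes>\<^bsub>?G\<^esub> \<sigma>) ` carrier ?G. c \<sigma> \<otimes>\<^bsub>E\<^esub> \<sigma> x)"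
      using c' cl x \<tau> by (intro finsum_reindex[symmetric]) (auto intro!: G.inj_on_multc inj_onI)
    also have "(\<lambda>\<sigma>. \<tau> \<otimes>\<^bsub>?G\<^esub> \<sigma>) ` carrier ?G = carrier ?G"
      using \<tau> by (rule G.surj_const_mult)
    finally show ?thesis by (simp add: y_def)
  qed
  have yu: "y x \<in> Units E" using x ycl by (simp add: field_Units)
  show ?thesis
  proof
    \<comment> \<open>The resolvent satisfies \<open>c \<tau> \<otimes> \<tau> y = y\<close>, with
      \<open>c\<close> on the wrong side; inverting it moves \<open>c\<close> across.\<close>
    show "inv\<^bsub>E\<^esub> y x \<in> carrier (mult_of E)" using yu by (simp add: field_Units[symmetric])
    fix \<tau> assume \<tau>: "\<tau> \<in> carrier ?G"
    have i: "inv\<^bsub>E\<^esub> y x \<in> carrier E" using yu by simp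
    have "\<tau> (inv\<^bsub>E\<^esub> y x) \<otimes>\<^bsub>E\<^esub> \<tau> (y x) = \<one>\<^bsub>E\<^esub>"
      using ring_hom_mult[OF aut(1)[OF \<tau>] i ycl[OF x(1)]] ring_hom_one[OF aut(1)[OF \<tau>]] yu by simp
    moreover have "c \<tau> \<otimes>\<^bsub>E\<^esub> inv\<^bsub>E\<^esub> y x \<otimes>\<^bsub>E\<^esub> \<tau> (y x) = \<one>\<^bsub>E\<^esub>"
      using yinv[OF \<tau>] yu i c' cl[OF \<tau>] ycl x(1) \<tau> by (metis Units_l_inv m_assoc m_comm)
    moreover have "\<tau> (y x) \<noteq> \<zero>\<^bsub>E\<^esub>"
      using yinv[OF \<tau>] x c'[OF \<tau>] by fastforce
    ultimately show "\<tau> (inv\<^bsub>E\<^esub> y x) = c \<tau> \<otimes>\<^bsub>E\<^esub> inv\<^bsub>E\<^esub> y x"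
      using m_rcancel[of "\<tau> (y x)"] i c' cl ycl x(1) \<tau> by (metis m_closed)
  qed
qed


section \<open>Extension of equivariant homomorphisms\<close>

locale group_module = G: group G + A: comm_group A
  for G :: "('g, 'm) monoid_scheme" and A :: "('a, 'n) monoid_scheme" +
  fixes act :: "'g \<Rightarrow> 'a \<Rightarrow> 'a"
  assumes act_hom: "g \<in> carrier G \<Longrightarrow> act g \<in> hom A A"
    and act_one: "a \<in> carrier A \<Longrightarrow> act \<one>\<^bsub>G\<^esub> a = a"
    and act_mult: "\<lbrakk>g \<in> carrier G; h \<in> carrier G; a \<in> carrier A\<rbrakk> \<Longrightarrow>
      act (g \<otimes>\<^bsub>G\<^esub> h) a = act g (act h a)"
begin

lemma act_closed [simp]: "\<lbrakk>g \<in> carrier G; a \<in> carrier A\<rbrakk> \<Longrightarrow> act g a \<in> carrier A"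
  using act_hom hom_in_carrier by metis

lemma act_group_hom: "g \<in> carrier G \<Longrightarrow> group_hom A A (act g)"
  by (simp add: act_hom group_hom.intro group_hom_axioms.intro A.group_axioms)

definition crossed_homs :: "('g \<Rightarrow> 'a) set" where
  "crossed_homs = {c \<in> carrier G \<rightarrow> carrier A.
    \<forall>g\<in>carrier G. \<forall>h\<in>carrier G. c (g \<otimes>\<^bsub>G\<^esub> h) = c g \<otimes>\<^bsub>A\<^esub> act g (c h)}"

text \<open>The coboundary condition \<open>c g = act g b / b\<close>, freed of division so that it
  has the shape of the conclusion of \<open>hilbert_90\<close>.\<close>

definition principal :: "('g \<Rightarrow> 'a) \<Rightarrow> bool" where
  "principal c \<longleftrightarrow> (\<exists>b\<in>carrier A. \<forall>g\<in>carrier G. act g b = c g \<otimes>\<^bsub>A\<^esub> b)"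

end

text \<open>Unlike in \<open>orbit_module_hom\<close>, no extensionality is demanded, so a map can
  be given by a formula without restricting it to the carrier.\<close>

definition equivariant_homs ::
    "('g, 'm) monoid_scheme \<Rightarrow> ('a, 'n) monoid_scheme \<Rightarrow> ('g \<Rightarrow> 'a \<Rightarrow> 'a)
      \<Rightarrow> ('b, 'k) monoid_scheme \<Rightarrow> ('g \<Rightarrow> 'b \<Rightarrow> 'b) \<Rightarrow> ('a \<Rightarrow> 'b) set" where
  "equivariant_homs G A actA B actB =
    {f \<in> hom A B. \<forall>g\<in>carrier G. \<forall>a\<in>carrier A. f (actA g a) = actB g (f a)}"

text \<open>
  With \<open>\<eta>'\<close> the homomorphism on \<open>ker \<epsilon> = d(W)\<close> induced by \<open>\<eta>\<close> and \<open>\<epsilon>(p) = 1\<close>, the obstruction to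
  extending \<open>\<eta>'\<close> to \<open>B\<close> equivariantly is the crossed homomorphism \<open>g \<mapsto> \<eta>'(g p - p)\<close>.
  If \<open>b\<close> makes it principal, the extension is \<open>\<zeta>(v) = \<eta>'(v - \<epsilon>(v) p) + \<epsilon>(v) b\<close>.
\<close>

lemma (in group_module) equivariant_extension:
  fixes B :: "('b, 'k) monoid_scheme" and W :: "('w, 'l) monoid_scheme"
  assumes H1: "\<And>c. c \<in> crossed_homs \<Longrightarrow> principal c"
    and B: "group_module G B actB" and W: "group_module G W actW"
    and d: "d \<in> equivariant_homs G W actW B actB"
    and \<epsilon>: "\<epsilon> \<in> equivariant_homs G B actB integer_group (\<lambda>_ n. n)" "\<epsilon> ` carrier B = UNIV"
    and exact: "d ` carrier W = kernel B integer_group \<epsilon>"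
    and \<eta>: "\<eta> \<in> equivariant_homs G W actW A act" "kernel W B d \<subseteq> kernel W A \<eta>"
  obtains \<zeta> where "\<zeta> \<in> equivariant_homs G B actB A act" "\<And>w. w \<in> carrier W \<Longrightarrow> \<zeta> (d w) = \<eta> w"
proof -
  interpret B: group_module G B actB by (rule B)
  interpret W: group_module G W actW by (rule W)
  interpret d: group_hom W B d
    using d by (simp add: equivariant_homs_def group_hom_def group_hom_axioms_def)
  interpret \<epsilon>: group_hom B integer_group \<epsilon>
    using \<epsilon>(1) by (simp add: equivariant_homs_def group_hom_def group_hom_axioms_def)
  interpret \<eta>: group_hom W A \<eta>
    using \<eta>(1) by (simp add: equivariant_homs_def group_hom_def group_hom_axioms_def)
  note [simp] = B.act_group_hom[THEN group_hom.hom_mult] B.act_group_hom[THEN group_hom.hom_inv]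
    act_group_hom[THEN group_hom.hom_mult] act_group_hom[THEN group_hom.hom_inv]
    B.act_group_hom[THEN group_hom.hom_int_pow] act_group_hom[THEN group_hom.hom_int_pow]
  have d_act: "d (actW g w) = actB g (d w)" if "g \<in> carrier G" "w \<in> carrier W" for g w
    using d that by (simp add: equivariant_homs_def)
  have \<epsilon>_act [simp]: "\<epsilon> (actB g v) = \<epsilon> v" if "g \<in> carrier G" "v \<in> carrier B" for g v
    using \<epsilon>(1) that by (simp add: equivariant_homs_def)
  have \<eta>_act: "\<eta> (actW g w) = act g (\<eta> w)" if "g \<in> carrier G" "w \<in> carrier W" for g w
    using \<eta>(1) that by (simp add: equivariant_homs_def)
  have \<eta>_cong: "\<eta> w = \<eta> w'" if w: "w \<in> carrier W" "w' \<in> carrier W" "d w = d w'" for w w'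
  proof -
    have "w \<otimes>\<^bsub>W\<^esub> inv\<^bsub>W\<^esub> w' \<in> kernel W B d"
      using w by (simp add: kernel_def)
    with \<eta>(2) have "w \<otimes>\<^bsub>W\<^esub> inv\<^bsub>W\<^esub> w' \<in> kernel W A \<eta>" by blast
    then have "\<eta> w \<otimes>\<^bsub>A\<^esub> inv\<^bsub>A\<^esub> \<eta> w' = \<one>\<^bsub>A\<^esub>"
      using w by (simp add: kernel_def)
    then show ?thesis using w by (simp add: A.inv_solve_right')
  qed
  \<comment> \<open>The map induced by \<open>\<eta>\<close> on the image of \<open>d\<close>; by
    \<open>\<eta>_cong\<close> the chosen preimage is immaterial.\<close>
  define \<kappa> where "\<kappa> v = \<eta> (SOME w. w \<in> carrier W \<and> d w = v)" for v
  have \<kappa>_d: "\<kappa> (d w) = \<eta> w" if "w \<in> carrier W" for w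
    using someI[of "\<lambda>w'. w' \<in> carrier W \<and> d w' = d w" w] that by (auto simp: \<kappa>_def intro: \<eta>_cong)
  have lift: "\<exists>w\<in>carrier W. v = d w" if "v \<in> carrier B" "\<epsilon> v = 0" for v
    using that exact by (auto simp: kernel_def)
  have \<kappa>_closed [simp]: "\<kappa> v \<in> carrier A" if "v \<in> carrier B" "\<epsilon> v = 0" for v
    using lift[OF that] \<kappa>_d by auto
  have \<kappa>_mult: "\<kappa> (v \<otimes>\<^bsub>B\<^esub> v') = \<kappa> v \<otimes>\<^bsub>A\<^esub> \<kappa> v'"
    if "v \<in> carrier B" "\<epsilon> v = 0" "v' \<in> carrier B" "\<epsilon> v' = 0" for v v'
    using lift[OF that(1,2)] lift[OF that(3,4)] by (auto simp: \<kappa>_d simp flip: d.hom_mult)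
  have \<kappa>_act: "\<kappa> (actB g v) = act g (\<kappa> v)" if "g \<in> carrier G" "v \<in> carrier B" "\<epsilon> v = 0" for g v
    using lift[OF that(2,3)] that(1) by (auto simp: \<kappa>_d \<eta>_act simp flip: d_act)
  have \<kappa>_pow: "\<kappa> (v [^]\<^bsub>B\<^esub> n) = \<kappa> v [^]\<^bsub>A\<^esub> n" if "v \<in> carrier B" "\<epsilon> v = 0" for v and n :: int
    using lift[OF that] by (auto simp: \<kappa>_d simp flip: d.hom_int_pow \<eta>.hom_int_pow)
  obtain p where p: "p \<in> carrier B" "\<epsilon> p = 1"
    using \<epsilon>(2) by (metis UNIV_I imageE)
  define c where "c g = \<kappa> (actB g p \<otimes>\<^bsub>B\<^esub> inv\<^bsub>B\<^esub> p)" for g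
  have c_closed [simp]: "c g \<in> carrier A" if "g \<in> carrier G" for g
    using that p by (simp add: c_def)
  have "c (g \<otimes>\<^bsub>G\<^esub> h) = c g \<otimes>\<^bsub>A\<^esub> act g (c h)" if "g \<in> carrier G" "h \<in> carrier G" for g h
  proof -
    \<comment> \<open>Additively \<open>g h p - p = (g p - p) + g (h p - p)\<close>; the auxiliary
      fact is applied with \<open>x\<close> equal to \<open>g h p\<close>.\<close>
    have "actB (g \<otimes>\<^bsub>G\<^esub> h) p \<otimes>\<^bsub>B\<^esub> inv\<^bsub>B\<^esub> p
        = (actB g p \<otimes>\<^bsub>B\<^esub> inv\<^bsub>B\<^esub> p) \<otimes>\<^bsub>B\<^esub> actB g (actB h p \<otimes>\<^bsub>B\<^esub> inv\<^bsub>B\<^esub> p)"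
    proof -
      have "(actB g p \<otimes>\<^bsub>B\<^esub> inv\<^bsub>B\<^esub> p) \<otimes>\<^bsub>B\<^esub> (x \<otimes>\<^bsub>B\<^esub> inv\<^bsub>B\<^esub> actB g p) = x \<otimes>\<^bsub>B\<^esub> inv\<^bsub>B\<^esub> p"
        if "x \<in> carrier B" for x
        using that p \<open>g \<in> carrier G\<close>
        by (simp add: B.A.m_ac)
      then show ?thesis using that p by (simp add: B.act_mult)
    qed
    then show ?thesis
      using that p \<kappa>_act[of g "actB h p \<otimes>\<^bsub>B\<^esub> inv\<^bsub>B\<^esub> p"] by (simp add: c_def \<kappa>_mult)
  qed
  then have "c \<in> crossed_homs" by (simp add: crossed_homs_def)
  then obtain b where b: "b \<in> carrier A" "\<And>g. g \<in> carrier G \<Longrightarrow> act g b = c g \<otimes>\<^bsub>A\<^esub> b"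
    using H1 unfolding principal_def by blast
  \<comment> \<open>The component of \<open>v\<close> in the kernel of \<open>\<epsilon>\<close>
    along the powers of \<open>p\<close>. This splitting is additive but need not be
    equivariant.\<close>
  define r where "r v = v \<otimes>\<^bsub>B\<^esub> inv\<^bsub>B\<^esub> (p [^]\<^bsub>B\<^esub> \<epsilon> v)" for v
  have \<epsilon>_pow: "\<epsilon> (p [^]\<^bsub>B\<^esub> n) = n" for n :: int
    using \<epsilon>.hom_int_pow[of p n] p by simp
  have r [simp]: "r v \<in> carrier B" "\<epsilon> (r v) = 0" if "v \<in> carrier B" for v
    using that p by (simp_all add: r_def \<epsilon>_pow)
  define \<zeta> where "\<zeta> v = \<kappa> (r v) \<otimes>\<^bsub>A\<^esub> b [^]\<^bsub>A\<^esub> \<epsilon> v" for v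
  show ?thesis
  proof
    have "\<zeta> (v \<otimes>\<^bsub>B\<^esub> v') = \<zeta> v \<otimes>\<^bsub>A\<^esub> \<zeta> v'" if "v \<in> carrier B" "v' \<in> carrier B" for v v'
    proof -
      have "r (v \<otimes>\<^bsub>B\<^esub> v') = r v \<otimes>\<^bsub>B\<^esub> r v'"
        using that p by (simp add: r_def B.A.int_pow_mult B.A.inv_mult B.A.m_ac)
      then show ?thesis
        using that b by (simp add: \<zeta>_def \<kappa>_mult A.int_pow_mult A.m_ac)
    qed
    moreover have "\<zeta> (actB g v) = act g (\<zeta> v)" if g: "g \<in> carrier G" and v: "v \<in> carrier B" for g v
    proof -
      let ?q = "actB g p \<otimes>\<^bsub>B\<^esub> inv\<^bsub>B\<^esub> p"
      have q: "?q \<in> carrier B" "\<epsilon> ?q = 0" using g p by simp_all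
      \<comment> \<open>Moving \<open>g\<close> past \<open>r\<close> costs
        \<open>\<epsilon> v\<close> copies of \<open>g p - p\<close>, whose value under
        \<open>\<kappa>\<close> is \<open>c g\<close>. They are absorbed by
        \<open>act g b = c g \<otimes> b\<close>.\<close>
      have "r (actB g v) = actB g (r v) \<otimes>\<^bsub>B\<^esub> ?q [^]\<^bsub>B\<^esub> \<epsilon> v"
        using g v p
        by (simp add: r_def B.A.int_pow_distrib B.A.int_pow_inv B.A.m_ac)
      then have "\<kappa> (r (actB g v)) = act g (\<kappa> (r v)) \<otimes>\<^bsub>A\<^esub> c g [^]\<^bsub>A\<^esub> \<epsilon> v"
        using g v q \<epsilon>.hom_int_pow[OF q(1), of "\<epsilon> v"]
        by (simp add: \<kappa>_mult \<kappa>_act \<kappa>_pow c_def del: \<epsilon>.hom_mult)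
      then show ?thesis
        using g v b by (simp add: \<zeta>_def A.int_pow_distrib A.m_assoc)
    qed
    ultimately show "\<zeta> \<in> equivariant_homs G B actB A act"
      using b by (auto simp: equivariant_homs_def hom_def \<zeta>_def)
    show "\<zeta> (d w) = \<eta> w" if w: "w \<in> carrier W" for w
    proof -
      \<comment> \<open>The exponent is 0 on the image of \<open>d\<close>, so neither
        \<open>p\<close> nor \<open>b\<close> contributes.\<close>
      have "\<epsilon> (d w) = 0" using exact w by (auto simp: kernel_def)
      then show ?thesis using w by (simp add: \<zeta>_def r_def \<kappa>_d)
    qed
  qed
qed


section \<open>The orbit category\<close>

lemma orbit_hom_apply:
  "\<lbrakk>\<phi> \<in> orbit_hom G H L; g \<in> carrier G; c \<in> lcosets\<^bsub>G\<^esub> H\<rbrakk> \<Longrightarrow>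
    \<phi> (g <#\<^bsub>G\<^esub> c) = g <#\<^bsub>G\<^esub> \<phi> c"
  by (simp add: orbit_hom_def)

context group
begin

lemma subgroup_in_lcosets: "subgroup H G \<Longrightarrow> H \<in> lcosets H"
  using lcos_mult_one[OF subgroup.subset] by (force simp: LCOSETS_def)

lemma lcosets_eq_l_coset:
  assumes "subgroup H G" "c \<in> lcosets H" "x \<in> c"
  shows "x \<in> carrier G" "c = x <# H"
proof -
  obtain y where y: "y \<in> carrier G" "c = y <# H" using assms(2) by (auto simp: LCOSETS_def)
  then show "x \<in> carrier G" "c = x <# H"
    using assms(3) l_coset_carrier[OF _ y(1) assms(1)] l_repr_independence[OF _ y(1) assms(1)] by auto
qed

text \<open>Any element of the coset \<open>\<phi> H\<close> can serve as the \<open>x\<close> in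
  the description of \<open>\<phi>\<close> as the map that sends \<open>H\<close> to
  \<open>xL\<close>.\<close>

lemma orbit_hom_image:
  assumes "subgroup H G" "subgroup L G" "\<phi> \<in> orbit_hom G H L" "x \<in> \<phi> H"
  shows "x \<in> carrier G" "\<phi> H = x <# L"
  using lcosets_eq_l_coset[OF assms(2) _ assms(4)] orbit_hom_funcset[OF assms(3)]
    subgroup_in_lcosets[OF assms(1)] by auto

lemma orbit_hom_image_nonempty:
  assumes "subgroup H G" "subgroup L G" "\<phi> \<in> orbit_hom G H L"
  obtains x where "x \<in> \<phi> H"
  using orbit_hom_funcset[OF assms(3)] subgroup_in_lcosets[OF assms(1)]
    lcos_self[OF _ assms(2)] by (force simp: LCOSETS_def)

text \<open>Since \<open>hH = H\<close>, equivariance forces \<open>h\<close> to preserve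
  \<open>\<phi> H\<close>. This is the condition that conjugation by \<open>x\<close> moves
  \<open>H\<close> into \<open>L\<close>, in the form needed to see that \<open>x\<close> carries
  elements fixed by \<open>L\<close> to elements fixed by \<open>H\<close>.\<close>

lemma orbit_hom_image_act:
  assumes "subgroup H G" "subgroup L G" "\<phi> \<in> orbit_hom G H L" "x \<in> \<phi> H" "h \<in> H"
  shows "h \<otimes> x \<in> \<phi> H"
proof -
  have h: "h \<in> carrier G" using assms(1,5) subgroup.mem_carrier by metis
  have "\<phi> (h <# H) = h <# \<phi> H"
    by (rule orbit_hom_apply[OF assms(3) h subgroup_in_lcosets[OF assms(1)]])
  moreover have "h <# H = H" using coset_join3[OF h assms(1,5)] .
  ultimately show ?thesis using assms(4) by (auto simp: l_coset_def)
qed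

text \<open>The base coset travels as \<open>H \<mapsto> xL \<mapsto> xyN\<close>: representatives
  multiply in the order of the arrows, opposite to the order in which functions are
  composed.\<close>

lemma orbit_hom_image_compose:
  assumes "subgroup H G" "subgroup L G" "subgroup N G"
    and "\<phi> \<in> orbit_hom G H L" "\<psi> \<in> orbit_hom G L N" "x \<in> \<phi> H" "y \<in> \<psi> L"
  shows "x \<otimes> y \<in> compose (lcosets H) \<psi> \<phi> H"
proof -
  note x = orbit_hom_image[OF assms(1,2,4,6)]
  have "\<psi> (x <# L) = x <# \<psi> L"
    by (rule orbit_hom_apply[OF assms(5) x(1) subgroup_in_lcosets[OF assms(2)]])
  then show ?thesis
    using assms(7) x(2) subgroup_in_lcosets[OF assms(1)] by (auto simp: compose_def l_coset_def)
qed

text \<open>The morphism \<open>G/1 \<rightarrow> G/L\<close> that sends \<open>1\<close> to \<open>xL\<close>.\<close>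

definition free_orbit_map :: "'a \<Rightarrow> 'a set \<Rightarrow> 'a set \<Rightarrow> 'a set" where
  "free_orbit_map x L = (\<lambda>c\<in>lcosets {\<one>}. c <#> (x <# L))"

lemma lcosets_one: "lcosets {\<one>} = (\<lambda>g. {g}) ` carrier G"
  by (auto simp: LCOSETS_def l_coset_def)

lemma free_orbit_map_apply:
  "\<lbrakk>g \<in> carrier G; x \<in> carrier G; L \<subseteq> carrier G\<rbrakk> \<Longrightarrow> free_orbit_map x L {g} = (g \<otimes> x) <# L"
  by (simp add: free_orbit_map_def lcosets_one lcos_m_assoc flip: l_coset_eq_set_mult)

lemma free_orbit_map_hom:
  assumes "x \<in> carrier G" "subgroup L G"
  shows "free_orbit_map x L \<in> orbit_hom G {\<one>} L"
proof -
  have L: "L \<subseteq> carrier G" using assms(2) subgroup.subset by blast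
  have "g <# {h} = {g \<otimes> h}" for g h by (simp add: l_coset_def)
  moreover have "free_orbit_map x L \<in> extensional (lcosets {\<one>})"
    by (simp add: free_orbit_map_def)
  ultimately show ?thesis
    using assms L
    by (auto simp: orbit_hom_def PiE_iff lcosets_one free_orbit_map_apply lcos_m_assoc m_assoc LCOSETS_def)
qed

lemma free_orbit_map_image:
  assumes "x \<in> carrier G" "subgroup L G"
  shows "x \<in> free_orbit_map x L {\<one>}"
  using assms subgroup.subset[OF assms(2)] lcos_self[OF assms] by (simp add: free_orbit_map_apply)

text \<open>Every point of \<open>G/1\<close> is a translate of the base point, so an equivariant
  map is determined by the coset to which it sends that point.\<close>

lemma orbit_hom_eq_free_orbit_map:
  assumes "subgroup L G" "\<phi> \<in> orbit_hom G {\<one>} L" "x \<in> \<phi> {\<one>}"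
  shows "\<phi> = free_orbit_map x L"
proof (rule extensionalityI[OF orbit_hom_ext[OF assms(2)]])
  show "free_orbit_map x L \<in> extensional (lcosets {\<one>})" by (simp add: free_orbit_map_def)
  fix c assume "c \<in> lcosets {\<one>}"
  then obtain g where g: "g \<in> carrier G" "c = {g}" by (auto simp: lcosets_one)
  note x = orbit_hom_image[OF triv_subgroup assms]
  have "\<phi> (g <# {\<one>}) = g <# \<phi> {\<one>}"
    by (rule orbit_hom_apply[OF assms(2) g(1) subgroup_in_lcosets[OF triv_subgroup]])
  then show "\<phi> c = free_orbit_map x L c"
    using g x subgroup.subset[OF assms(1)]
    by (simp add: l_coset_def[of _ _ "{\<one>}"] free_orbit_map_apply lcos_m_assoc)
qed

text \<open>Both sides start at \<open>G/1\<close>, so it is enough to find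
  \<open>x \<otimes> y\<close> in the coset to which the composite sends the base point.\<close>

lemma free_orbit_map_compose:
  assumes "subgroup H G" "subgroup L G" "\<phi> \<in> orbit_hom G H L" "x \<in> carrier G" "y \<in> \<phi> H"
  shows "compose (lcosets {\<one>}) \<phi> (free_orbit_map x H) = free_orbit_map (x \<otimes> y) L"
  by (intro orbit_hom_eq_free_orbit_map orbit_hom_image_compose[OF triv_subgroup assms(1,2)]
      orbit_hom_compose[OF is_group triv_subgroup _ assms(3)] free_orbit_map_hom free_orbit_map_image assms)

lemma free_orbit_map_cong:
  assumes "subgroup L G" "x \<in> L"
  shows "free_orbit_map x L = free_orbit_map \<one> L"
  using assms coset_join3[of x L] lcos_mult_one[OF subgroup.subset[OF assms(1)]]
    subgroup.mem_carrier[OF assms] by (simp add: free_orbit_map_def)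

lemma free_orbit_map_one: "free_orbit_map \<one> {\<one>} = (\<lambda>c\<in>lcosets {\<one>}. c)"
  using orbit_hom_eq_free_orbit_map[OF triv_subgroup orbit_hom_id[OF is_group triv_subgroup], of \<one>]
    subgroup_in_lcosets[OF triv_subgroup] by simp

end


section \<open>Modules over the orbit category\<close>

lemma orbit_module_D:
  assumes "orbit_module G F M" "H \<in> F"
  shows "comm_group (obj M H)"
    and "\<And>L \<phi>. \<lbrakk>L \<in> F; \<phi> \<in> orbit_hom G H L\<rbrakk> \<Longrightarrow> arr M H L \<phi> \<in> hom (obj M L) (obj M H)"
    and "\<And>a. a \<in> carrier (obj M H) \<Longrightarrow> arr M H H (\<lambda>c\<in>lcosets\<^bsub>G\<^esub> H. c) a = a"
    and "\<And>L N \<phi> \<psi> a. \<lbrakk>L \<in> F; N \<in> F; \<phi> \<in> orbit_hom G H L; \<psi> \<in> orbit_hom G L N; a \<in> carrier (obj M N)\<rbrakk>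
      \<Longrightarrow> arr M H N (compose (lcosets\<^bsub>G\<^esub> H) \<psi> \<phi>) a = arr M H L \<phi> (arr M L N \<psi> a)"
  using assms by (simp_all add: orbit_module_def)

section \<open>Hom groups between modules and the cochain differential\<close>

text \<open>The operations are pointwise; products and inverses of homomorphisms are homomorphisms
  because the values of \<open>N\<close> are commutative. This is what makes
  \<open>ext_group\<close> a quotient inside an actual group.\<close>

lemma comm_group_orbit_hom_group:
  assumes M: "orbit_module G F M" and N: "orbit_module G F N"
  shows "comm_group (orbit_hom_group G F M N)"
proof (rule comm_groupI; (simp only: orbit_hom_group_def partial_object.simps monoid.simps)?)
  have cgN: "comm_group (obj N H)" if "H \<in> F" for H
    using orbit_module_D(1)[OF N that] .
  have arrN: "group_hom (obj N L) (obj N H) (arr N H L \<phi>)" if "H \<in> F" "L \<in> F" "\<phi> \<in> orbit_hom G H L" for H L \<phi>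
    using orbit_module_D(2)[OF N that] cgN[OF that(1)] cgN[OF that(2)]
    by (simp add: group_hom_def group_hom_axioms_def comm_group.axioms)
  note closed = orbit_module_hom_D(3)
  let ?mult = "\<lambda>\<eta> \<theta>. \<lambda>H\<in>F. \<lambda>a\<in>carrier (obj M H). \<eta> H a \<otimes>\<^bsub>obj N H\<^esub> \<theta> H a"
  let ?one = "\<lambda>H\<in>F. \<lambda>a\<in>carrier (obj M H). \<one>\<^bsub>obj N H\<^esub>"
  have arrM: "arr M H L \<phi> a \<in> carrier (obj M H)"
    if "H \<in> F" "L \<in> F" "\<phi> \<in> orbit_hom G H L" "a \<in> carrier (obj M L)" for H L \<phi> a
    using orbit_module_arr_closed[OF M that] .
  have Mm: "a \<otimes>\<^bsub>obj M H\<^esub> b \<in> carrier (obj M H)"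
    if "H \<in> F" "a \<in> carrier (obj M H)" "b \<in> carrier (obj M H)" for H a b
    using monoid.m_closed[OF orbit_module_monoid[OF M that(1)] that(2,3)] .
  show one: "?one \<in> orbit_module_hom G F M N"
  proof (rule orbit_module_hom_I)
    fix H assume H: "H \<in> F"
    interpret comm_group "obj N H" by (rule cgN[OF H])
    show "?one H \<in> hom (obj M H) (obj N H)" using H by (auto simp: hom_def Mm)
  next
    fix H L \<phi> a assume *: "H \<in> F" "L \<in> F" "\<phi> \<in> orbit_hom G H L" "a \<in> carrier (obj M L)"
    then show "?one H (arr M H L \<phi> a) = arr N H L \<phi> (?one L a)"
      using arrM[OF *] group_hom.hom_one[OF arrN[OF *(1-3)]] by simp
  qed auto
  \<comment> \<open>Transformations are extensional both in the object and in the element, which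
    reduces the group laws to identities in each \<open>obj N H\<close>.\<close>
  have ext: "\<eta> = \<theta>"
    if \<eta>: "\<eta> \<in> orbit_module_hom G F M N" and \<theta>: "\<theta> \<in> orbit_module_hom G F M N"
      and eq: "\<And>H a. \<lbrakk>H \<in> F; a \<in> carrier (obj M H)\<rbrakk> \<Longrightarrow> \<eta> H a = \<theta> H a" for \<eta> \<theta>
  proof (rule extensionalityI[of _ F])
    show "\<eta> \<in> extensional F" "\<theta> \<in> extensional F"
      using \<eta> \<theta> by (auto simp: orbit_module_hom_def PiE_iff)
    show "\<eta> H = \<theta> H" if H: "H \<in> F" for H
      using orbit_module_hom_D(2)[OF \<eta> H] orbit_module_hom_D(2)[OF \<theta> H] eq[OF H]
      by (rule extensionalityI)
  qed
  show mult: "?mult \<eta> \<theta> \<in> orbit_module_hom G F M N"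
    if "\<eta> \<in> orbit_module_hom G F M N" "\<theta> \<in> orbit_module_hom G F M N" for \<eta> \<theta>
  proof (rule orbit_module_hom_I)
    fix H assume H: "H \<in> F"
    interpret comm_group "obj N H" by (rule cgN[OF H])
    show "?mult \<eta> \<theta> H \<in> hom (obj M H) (obj N H)"
      using H closed[OF that(1) H] closed[OF that(2) H]
        hom_mult[OF orbit_module_hom_D(1)[OF that(1) H]] hom_mult[OF orbit_module_hom_D(1)[OF that(2) H]]
      by (auto simp: Mm m_ac intro!: homI)
  next
    fix H L \<phi> a assume *: "H \<in> F" "L \<in> F" "\<phi> \<in> orbit_hom G H L" "a \<in> carrier (obj M L)"
    then show "?mult \<eta> \<theta> H (arr M H L \<phi> a) = arr N H L \<phi> (?mult \<eta> \<theta> L a)"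
      using arrM[OF *] group_hom.hom_mult[OF arrN[OF *(1-3)]]
        closed[OF that(1) *(2,4)] closed[OF that(2) *(2,4)]
        orbit_module_hom_nat[OF that(1) *] orbit_module_hom_nat[OF that(2) *] by simp
  qed auto
  show "?mult (?mult \<eta> \<theta>) \<zeta> = ?mult \<eta> (?mult \<theta> \<zeta>)"
    if "\<eta> \<in> orbit_module_hom G F M N" "\<theta> \<in> orbit_module_hom G F M N" "\<zeta> \<in> orbit_module_hom G F M N" for \<eta> \<theta> \<zeta>
    using that closed[OF that(1)] closed[OF that(2)] closed[OF that(3)]
    by (intro ext mult)
      (auto simp: monoid.m_assoc[OF orbit_module_monoid[OF N]])
  show "?mult \<eta> \<theta> = ?mult \<theta> \<eta>"
    if "\<eta> \<in> orbit_module_hom G F M N" "\<theta> \<in> orbit_module_hom G F M N" for \<eta> \<theta>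
    using that closed[OF that(1)] closed[OF that(2)]
    by (intro ext mult) (auto intro!: comm_monoid.m_comm[OF comm_group.axioms(1)[OF cgN]])
  show "?mult ?one \<eta> = \<eta>" if "\<eta> \<in> orbit_module_hom G F M N" for \<eta>
    using that closed[OF that] monoid.l_one[OF orbit_module_monoid[OF N]]
    by (intro ext mult one) auto
  show "\<exists>\<theta>\<in>orbit_module_hom G F M N. ?mult \<theta> \<eta> = ?one" if \<eta>: "\<eta> \<in> orbit_module_hom G F M N" for \<eta>
  proof
    let ?inv = "\<lambda>H\<in>F. \<lambda>a\<in>carrier (obj M H). inv\<^bsub>obj N H\<^esub> \<eta> H a"
    show inv: "?inv \<in> orbit_module_hom G F M N"
    proof (rule orbit_module_hom_I)
      fix H assume H: "H \<in> F"
      interpret comm_group "obj N H" by (rule cgN[OF H])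
      show "?inv H \<in> hom (obj M H) (obj N H)"
        using H closed[OF \<eta> H] hom_mult[OF orbit_module_hom_D(1)[OF \<eta> H]]
        by (auto simp: Mm inv_mult intro!: homI)
    next
      fix H L \<phi> a assume *: "H \<in> F" "L \<in> F" "\<phi> \<in> orbit_hom G H L" "a \<in> carrier (obj M L)"
      then show "?inv H (arr M H L \<phi> a) = arr N H L \<phi> (?inv L a)"
        using arrM[OF *] group_hom.hom_inv[OF arrN[OF *(1-3)]]
          closed[OF \<eta> *(2,4)] orbit_module_hom_nat[OF \<eta> *] by simp
    qed auto
    show "?mult ?inv \<eta> = ?one"
      using closed[OF \<eta>] group.l_inv[OF comm_group.axioms(2)[OF cgN]]
      by (intro ext mult one inv \<eta>) auto
  qed
qed

text \<open>Precomposition respects products formed pointwise in the target. Applied to the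
  differential, it turns the cocycles into the kernel of a group homomorphism.\<close>

lemma orbit_module_comp_group_hom:
  assumes M: "orbit_module G F M" and M': "orbit_module G F M'" and N: "orbit_module G F N"
    and d: "d \<in> orbit_module_hom G F M' M"
  shows "group_hom (orbit_hom_group G F M N) (orbit_hom_group G F M' N)
    (\<lambda>\<eta>. orbit_module_comp F M' \<eta> d)"
proof (intro group_hom.intro group_hom_axioms.intro)
  show "group (orbit_hom_group G F M N)" "group (orbit_hom_group G F M' N)"
    by (intro comm_group.axioms(2) comm_group_orbit_hom_group M M' N)+
  show "(\<lambda>\<eta>. orbit_module_comp F M' \<eta> d) \<in> hom (orbit_hom_group G F M N) (orbit_hom_group G F M' N)"
    using orbit_module_comp_hom[OF M' d] orbit_module_hom_D(3)[OF d]
    by (intro homI) (auto simp: orbit_hom_group_def orbit_module_comp_def compose_def fun_eq_iff restrict_def)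
qed

section \<open>The fixed point functor as a module over the orbit category\<close>

context group_module
begin

definition fixed_points :: "'g set \<Rightarrow> 'a set" where
  "fixed_points H = {a \<in> carrier A. \<forall>h\<in>H. act h a = a}"

lemma subgroup_fixed_points:
  assumes "H \<subseteq> carrier G"
  shows "subgroup (fixed_points H) A"
proof (rule A.subgroupI)
  show "fixed_points H \<noteq> {}"
    using act_group_hom[THEN group_hom.hom_one] assms by (auto simp: fixed_points_def)
qed (use assms act_group_hom[THEN group_hom.hom_mult] act_group_hom[THEN group_hom.hom_inv]
    in \<open>auto simp: fixed_points_def subset_iff\<close>)

lemma fixed_points_one: "fixed_points {\<one>\<^bsub>G\<^esub>} = carrier A"
  by (auto simp: fixed_points_def act_one)

end

context
  fixes G :: "('g, 'm) monoid_scheme" and A :: "'a monoid" and act :: "'g \<Rightarrow> 'a \<Rightarrow> 'a"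
  assumes GA: "group_module G A act"
begin

interpretation group_module G A act by (rule GA)

lemma obj_fixed_point_module: "obj (fixed_point_module A act) H = A\<lparr>carrier := fixed_points H\<rparr>"
  by (simp add: fixed_point_module_def fixed_points_def)

text \<open>The representative picked by \<open>SOME\<close> is \<open>x \<otimes> l\<close> with
  \<open>l\<close> in \<open>L\<close>, and \<open>l\<close> fixes \<open>a\<close>. Later arguments
  can thus use whichever representative suits them.\<close>

lemma arr_fixed_point_module:
  assumes "subgroup H G" "subgroup L G" "\<phi> \<in> orbit_hom G H L" "x \<in> \<phi> H" "a \<in> fixed_points L"
  shows "arr (fixed_point_module A act) H L \<phi> a = act x a"
proof -
  note x = G.orbit_hom_image[OF assms(1-4)]
  have "(SOME y. y \<in> \<phi> H) \<in> \<phi> H" using assms(4) by (rule someI)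
  then obtain l where l: "l \<in> L" "(SOME y. y \<in> \<phi> H) = x \<otimes>\<^bsub>G\<^esub> l"
    unfolding x(2) by (auto simp: l_coset_def)
  then show ?thesis
    using x(1) assms(5) subgroup.mem_carrier[OF assms(2) l(1)]
    by (simp add: fixed_point_module_def fixed_points_def act_mult)
qed

lemma orbit_module_fixed_point_module:
  assumes "subgroup_family G F"
  shows "orbit_module G F (fixed_point_module A act)"
  unfolding orbit_module_def obj_fixed_point_module
proof (intro conjI ballI)
  have sub: "subgroup H G" if "H \<in> F" for H
    using assms that by (simp add: subgroup_family_def)
  show "comm_group (A\<lparr>carrier := fixed_points H\<rparr>)" if "H \<in> F" for H
    using A.subgroup_imp_group[OF subgroup_fixed_points[OF subgroup.subset[OF sub[OF that]]]]
    by (rule group.group_comm_groupI) (auto simp: fixed_points_def A.m_comm)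
  have fixed: "act x a \<in> fixed_points H"
    if H: "subgroup H G" and L: "subgroup L G" and \<phi>: "\<phi> \<in> orbit_hom G H L"
      and x: "x \<in> \<phi> H" and a: "a \<in> fixed_points L" for H L \<phi> x a
  proof -
    note x' = G.orbit_hom_image[OF H L \<phi> x]
    \<comment> \<open>Both \<open>x\<close> and \<open>h \<otimes> x\<close> represent the same
      coset, and the induced map may be computed from either.\<close>
    have "act h (act x a) = act x a" if h: "h \<in> H" for h
      using arr_fixed_point_module[OF H L \<phi> G.orbit_hom_image_act[OF H L \<phi> x h] a]
        arr_fixed_point_module[OF H L \<phi> x a] x'(1) a subgroup.mem_carrier[OF H h]
      by (simp add: act_mult fixed_points_def)
    then show ?thesis using x'(1) a by (simp add: fixed_points_def)
  qed
  show "arr (fixed_point_module A act) H L \<phi> \<in> hom (A\<lparr>carrier := fixed_points L\<rparr>) (A\<lparr>carrier := fixed_points H\<rparr>)"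
    if HL: "H \<in> F" "L \<in> F" and \<phi>: "\<phi> \<in> orbit_hom G H L" for H L \<phi>
  proof -
    note HL' = sub[OF HL(1)] sub[OF HL(2)]
    obtain x where x: "x \<in> \<phi> H" by (rule G.orbit_hom_image_nonempty[OF HL' \<phi>])
    have mult: "a \<otimes>\<^bsub>A\<^esub> b \<in> fixed_points L" if "a \<in> fixed_points L" "b \<in> fixed_points L" for a b
      using subgroup.m_closed[OF subgroup_fixed_points[OF subgroup.subset[OF HL'(2)]] that] .
    have "fixed_points L \<subseteq> carrier A" by (auto simp: fixed_points_def)
    then show ?thesis
      using fixed[OF HL' \<phi> x] arr_fixed_point_module[OF HL' \<phi> x] mult
        group_hom.hom_mult[OF act_group_hom[OF G.orbit_hom_image(1)[OF HL' \<phi> x]]]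
      by (intro homI) (auto simp: subset_iff)
  qed
  show "arr (fixed_point_module A act) H H (\<lambda>c\<in>lcosets\<^bsub>G\<^esub> H. c) a = a"
    if H: "H \<in> F" and a: "a \<in> carrier (A\<lparr>carrier := fixed_points H\<rparr>)" for H a
    using arr_fixed_point_module[OF sub[OF H] sub[OF H] orbit_hom_id[OF G.is_group sub[OF H]], of "\<one>\<^bsub>G\<^esub>" a]
      G.subgroup_in_lcosets[OF sub[OF H]] subgroup.one_closed[OF sub[OF H]] a
    by (simp add: act_one fixed_points_def)
  show "arr (fixed_point_module A act) H N (compose (lcosets\<^bsub>G\<^esub> H) \<psi> \<phi>) a
      = arr (fixed_point_module A act) H L \<phi> (arr (fixed_point_module A act) L N \<psi> a)"
    if F: "H \<in> F" "L \<in> F" "N \<in> F" and \<phi>: "\<phi> \<in> orbit_hom G H L" and \<psi>: "\<psi> \<in> orbit_hom G L N"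
      and a: "a \<in> carrier (A\<lparr>carrier := fixed_points N\<rparr>)" for H L N \<phi> \<psi> a
  proof -
    note H = sub[OF F(1)] and L = sub[OF F(2)] and N = sub[OF F(3)]
    have a: "a \<in> fixed_points N" using a by simp
    obtain x where x: "x \<in> \<phi> H" by (rule G.orbit_hom_image_nonempty[OF H L \<phi>])
    obtain y where y: "y \<in> \<psi> L" by (rule G.orbit_hom_image_nonempty[OF L N \<psi>])
    have "arr (fixed_point_module A act) H N (compose (lcosets\<^bsub>G\<^esub> H) \<psi> \<phi>) a = act (x \<otimes>\<^bsub>G\<^esub> y) a"
      by (intro arr_fixed_point_module H N a orbit_hom_compose[OF G.is_group H \<phi> \<psi>]
          G.orbit_hom_image_compose[OF H L N \<phi> \<psi> x y])
    also have "\<dots> = act x (act y a)"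
      using G.orbit_hom_image(1)[OF H L \<phi> x] G.orbit_hom_image(1)[OF L N \<psi> y] a
      by (simp add: act_mult fixed_points_def)
    also have "\<dots> = arr (fixed_point_module A act) H L \<phi> (arr (fixed_point_module A act) L N \<psi> a)"
      by (simp add: arr_fixed_point_module[OF L N \<psi> y a]
          arr_fixed_point_module[OF H L \<phi> x fixed[OF L N \<psi> y a]])
    finally show ?thesis .
  qed
qed

end

section \<open>Evaluation at \<open>G/1\<close> and the first Ext group\<close>

text \<open>The endomorphisms of \<open>G/1\<close> are right multiplications, whose composition
  reverses products; contravariance of \<open>M\<close> reverses them once more, so the result is a
  left action.\<close>

lemma group_module_orbit_module:
  assumes G: "group G" and one: "{\<one>\<^bsub>G\<^esub>} \<in> F" and M: "orbit_module G F M"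
  shows "group_module G (obj M {\<one>\<^bsub>G\<^esub>})
    (\<lambda>x. arr M {\<one>\<^bsub>G\<^esub>} {\<one>\<^bsub>G\<^esub>} (group.free_orbit_map G x {\<one>\<^bsub>G\<^esub>}))"
proof -
  interpret G: group G by fact
  note T = G.triv_subgroup
  show ?thesis
  proof (intro group_module.intro group_module_axioms.intro G.is_group)
    show "comm_group (obj M {\<one>\<^bsub>G\<^esub>})" by (rule orbit_module_D(1)[OF M one])
    show "arr M {\<one>\<^bsub>G\<^esub>} {\<one>\<^bsub>G\<^esub>} (G.free_orbit_map x {\<one>\<^bsub>G\<^esub>}) \<in> hom (obj M {\<one>\<^bsub>G\<^esub>}) (obj M {\<one>\<^bsub>G\<^esub>})"
      if "x \<in> carrier G" for x
      by (rule orbit_module_D(2)[OF M one one G.free_orbit_map_hom[OF that T]])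
    show "arr M {\<one>\<^bsub>G\<^esub>} {\<one>\<^bsub>G\<^esub>} (G.free_orbit_map \<one>\<^bsub>G\<^esub> {\<one>\<^bsub>G\<^esub>}) a = a" if "a \<in> carrier (obj M {\<one>\<^bsub>G\<^esub>})" for a
      using orbit_module_D(3)[OF M one that] by (simp add: G.free_orbit_map_one)
    show "arr M {\<one>\<^bsub>G\<^esub>} {\<one>\<^bsub>G\<^esub>} (G.free_orbit_map (x \<otimes>\<^bsub>G\<^esub> y) {\<one>\<^bsub>G\<^esub>}) a =
        arr M {\<one>\<^bsub>G\<^esub>} {\<one>\<^bsub>G\<^esub>} (G.free_orbit_map x {\<one>\<^bsub>G\<^esub>}) (arr M {\<one>\<^bsub>G\<^esub>} {\<one>\<^bsub>G\<^esub>} (G.free_orbit_map y {\<one>\<^bsub>G\<^esub>}) a)"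
      if "x \<in> carrier G" "y \<in> carrier G" "a \<in> carrier (obj M {\<one>\<^bsub>G\<^esub>})" for x y a
      using orbit_module_D(4)[OF M one one one G.free_orbit_map_hom[OF that(1) T] G.free_orbit_map_hom[OF that(2) T] that(3)]
        G.free_orbit_map_compose[OF T T G.free_orbit_map_hom[OF that(2) T] that(1) G.free_orbit_map_image[OF that(2) T]]
      by simp
  qed
qed

lemma group_trivial_Mod_self:
  assumes "group G"
  shows "trivial_group (G Mod carrier G)"
proof -
  interpret group G by fact
  have "carrier (G Mod carrier G) = {carrier G}"
    using coset_join2[OF _ subgroup_self] by (auto simp: carrier_FactGroup)
  then show ?thesis
    using normal.factorgroup_is_group[OF normal_self] by (simp add: trivial_group_def)
qed

text \<open>Exactness contains \<open>d d = 0\<close>. Together with the opposite inclusion in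
  degree 1 it makes the Ext group a quotient of a group by itself.\<close>

lemma ext_coboundaries_subset_cocycles:
  assumes res: "projective_resolution G F M P d \<epsilon>" and N: "orbit_module G F N"
  shows "ext_coboundaries G F P d N (Suc n) \<subseteq> ext_cocycles G F P d N (Suc n)"
proof
  have P: "orbit_module G F (P i)" and d: "d i \<in> orbit_module_hom G F (P (Suc i)) (P i)" for i
    using res by (auto simp: projective_resolution_def orbit_projective_def)
  fix \<eta> assume "\<eta> \<in> ext_coboundaries G F P d N (Suc n)"
  then obtain \<zeta> where \<zeta>: "\<zeta> \<in> orbit_module_hom G F (P n) N"
    and \<eta>: "\<eta> = orbit_module_comp F (P (Suc n)) \<zeta> (d n)"
    by (auto simp: ext_coboundaries_def)
  have "\<eta> H (d (Suc n) H u) = \<one>\<^bsub>obj N H\<^esub>"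
    if H: "H \<in> F" and u: "u \<in> carrier (obj (P (Suc (Suc n))) H)" for H u
  proof -
    have "d (Suc n) H u \<in> kernel (obj (P (Suc n)) H) (obj (P n) H) (d n H)"
      using res H u unfolding projective_resolution_def by blast
    then have "\<eta> H (d (Suc n) H u) = \<zeta> H \<one>\<^bsub>obj (P n) H\<^esub>"
      using H by (simp add: \<eta> orbit_module_comp_def compose_def kernel_def)
    also have "\<dots> = \<one>\<^bsub>obj N H\<^esub>"
      using orbit_module_hom_D(1)[OF \<zeta> H] orbit_module_D(1)[OF P H] orbit_module_D(1)[OF N H]
      by (intro hom_one) (auto intro: comm_group.axioms)
    finally show ?thesis .
  qed
  then have "orbit_module_comp F (P (Suc (Suc n))) \<eta> (d (Suc n))
      = \<one>\<^bsub>orbit_hom_group G F (P (Suc (Suc n))) N\<^esub>"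
    by (auto simp: orbit_module_comp_def compose_def orbit_hom_group_def fun_eq_iff restrict_def)
  moreover have "\<eta> \<in> orbit_module_hom G F (P (Suc n)) N"
    unfolding \<eta> by (rule orbit_module_comp_hom[OF P d \<zeta>])
  ultimately show "\<eta> \<in> ext_cocycles G F P d N (Suc n)"
    by (simp add: ext_cocycles_def kernel_def orbit_hom_group_def)
qed

text \<open>
  The value at \<open>G/1\<close> determines everything: a cocycle is trivialised there by an equivariant
  \<open>\<zeta>\<close>, and \<open>u \<mapsto> \<zeta>(r\<^sub>H(u))\<close> with \<open>r\<^sub>H\<close> induced by \<open>G/1 \<rightarrow> G/H\<close> trivialises it at \<open>G/H\<close>.
\<close>

lemma ext_1_fixed_point_module_cocycles:
  fixes A :: "'a monoid"
  assumes GA: "group_module G A act"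
    and H1: "\<And>c. c \<in> group_module.crossed_homs G A act \<Longrightarrow> group_module.principal G A act c"
    and fam: "subgroup_family G F" and one: "{\<one>\<^bsub>G\<^esub>} \<in> F"
    and res: "projective_resolution G F (constant_module integer_group) P d \<epsilon>"
  shows "ext_cocycles G F P d (fixed_point_module A act) (Suc 0)
    \<subseteq> ext_coboundaries G F P d (fixed_point_module A act) (Suc 0)"
proof
  interpret group_module G A act by (rule GA)
  let ?N = "fixed_point_module A act" and ?I = "{\<one>\<^bsub>G\<^esub>}"
  let ?actM = "\<lambda>M x. arr M ?I ?I (G.free_orbit_map x ?I)"
  note T = G.triv_subgroup and obj_N = obj_fixed_point_module[OF GA]
    and arr_N = arr_fixed_point_module[OF GA]
  have N: "orbit_module G F ?N" by (rule orbit_module_fixed_point_module[OF GA fam])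
  have P: "orbit_module G F (P i)" and d: "d i \<in> orbit_module_hom G F (P (Suc i)) (P i)" for i
    using res by (auto simp: projective_resolution_def orbit_projective_def)
  have \<epsilon>: "\<epsilon> \<in> orbit_module_hom G F (P 0) (constant_module integer_group)"
    "orbit_module_epi F (P 0) (constant_module integer_group) \<epsilon>"
    using res by (auto simp: projective_resolution_def)
  have sub: "subgroup H G" if "H \<in> F" for H
    using fam that by (simp add: subgroup_family_def)
  have obj_I: "obj ?N ?I = A"
    by (simp add: obj_N fixed_points_one)
  have free: "G.free_orbit_map x H \<in> orbit_hom G ?I H" if "x \<in> carrier G" "H \<in> F" for x H
    by (rule G.free_orbit_map_hom[OF that(1) sub[OF that(2)]])
  \<comment> \<open>Equivariance is naturality with respect to the endomorphisms of
    \<open>G/1\<close>.\<close>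
  have equiv: "\<theta> ?I \<in> equivariant_homs G (obj M ?I) (?actM M) (obj M' ?I) (?actM M')"
    if "\<theta> \<in> orbit_module_hom G F M M'" for \<theta> :: "'b set \<Rightarrow> 'x \<Rightarrow> 'y" and M M'
    using orbit_module_hom_D(1)[OF that one] orbit_module_hom_nat[OF that one one free[OF _ one]]
    by (simp add: equivariant_homs_def)
  fix \<eta> assume "\<eta> \<in> ext_cocycles G F P d ?N (Suc 0)"
  then have \<eta>: "\<eta> \<in> orbit_module_hom G F (P (Suc 0)) ?N"
    and cocycle: "orbit_module_comp F (P (Suc (Suc 0))) \<eta> (d (Suc 0))
      = \<one>\<^bsub>orbit_hom_group G F (P (Suc (Suc 0))) ?N\<^esub>"
    by (simp_all add: ext_cocycles_def kernel_def orbit_hom_group_def)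
  have \<eta>_I: "\<eta> ?I \<in> equivariant_homs G (obj (P (Suc 0)) ?I) (?actM (P (Suc 0))) A act"
    using equiv[OF \<eta>] arr_N[OF T T free[OF _ one] G.free_orbit_map_image[OF _ T]]
      orbit_module_hom_D(3)[OF \<eta> one]
    by (simp add: equivariant_homs_def obj_I fixed_points_one)
  \<comment> \<open>The kernel of \<open>d 0\<close> is the image of \<open>d 1\<close>, and being a
    cocycle means vanishing there.\<close>
  have \<eta>_ker: "kernel (obj (P (Suc 0)) ?I) (obj (P 0) ?I) (d 0 ?I) \<subseteq> kernel (obj (P (Suc 0)) ?I) A (\<eta> ?I)"
  proof
    fix w assume w: "w \<in> kernel (obj (P (Suc 0)) ?I) (obj (P 0) ?I) (d 0 ?I)"
    then obtain u where u: "u \<in> carrier (obj (P (Suc (Suc 0))) ?I)" "w = d (Suc 0) ?I u"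
      using res one unfolding projective_resolution_def by blast
    have "\<eta> ?I w = \<one>\<^bsub>A\<^esub>"
      using fun_cong[OF fun_cong[OF cocycle], of ?I u] u one
      by (simp add: orbit_module_comp_def compose_def orbit_hom_group_def obj_I)
    with w show "w \<in> kernel (obj (P (Suc 0)) ?I) A (\<eta> ?I)" by (simp add: kernel_def)
  qed
  have \<epsilon>_I: "\<epsilon> ?I \<in> equivariant_homs G (obj (P 0) ?I) (?actM (P 0)) integer_group (\<lambda>_ n. n)"
    "\<epsilon> ?I ` carrier (obj (P 0) ?I) = UNIV"
    "d 0 ?I ` carrier (obj (P (Suc 0)) ?I) = kernel (obj (P 0) ?I) integer_group (\<epsilon> ?I)"
    using equiv[OF \<epsilon>(1)] \<epsilon>(2) one res
    by (simp_all add: constant_module_def orbit_module_epi_def projective_resolution_def)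
  obtain \<zeta> where \<zeta>: "\<zeta> \<in> equivariant_homs G (obj (P 0) ?I) (?actM (P 0)) A act"
    and \<zeta>_d: "\<And>w. w \<in> carrier (obj (P (Suc 0)) ?I) \<Longrightarrow> \<zeta> (d 0 ?I w) = \<eta> ?I w"
    by (rule equivariant_extension[OF H1 group_module_orbit_module[OF G.is_group one P]
          group_module_orbit_module[OF G.is_group one P] equiv[OF d] \<epsilon>_I \<eta>_I \<eta>_ker]) auto
  have \<zeta>_hom: "\<zeta> \<in> hom (obj (P 0) ?I) A"
    and \<zeta>_act: "\<And>x u. \<lbrakk>x \<in> carrier G; u \<in> carrier (obj (P 0) ?I)\<rbrakk> \<Longrightarrow> \<zeta> (?actM (P 0) x u) = act x (\<zeta> u)"
    using \<zeta> by (auto simp: equivariant_homs_def)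
  let ?r = "\<lambda>i H. arr (P i) ?I H (G.free_orbit_map \<one>\<^bsub>G\<^esub> H)"
  have r: "?r i H \<in> hom (obj (P i) H) (obj (P i) ?I)" if "H \<in> F" for i H
    by (rule orbit_module_D(2)[OF P one that free[OF G.one_closed that]])
  have r_closed: "?r i H u \<in> carrier (obj (P i) ?I)" if "H \<in> F" "u \<in> carrier (obj (P i) H)" for i H u
    using hom_in_carrier[OF r] that by blast
  \<comment> \<open>The square of \<open>\<phi>\<close> with the projections from \<open>G/1\<close>
    commutes once \<open>G/1\<close> is multiplied by \<open>x\<close>: both composites to
    \<open>G/L\<close> send the base point to \<open>xL\<close>. They are
    \<open>free_orbit_map\<close> at \<open>\<one> \<otimes> x\<close> and at
    \<open>x \<otimes> \<one>\<close>.\<close>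
  have arr_r: "?r i H (arr (P i) H L \<phi> u) = ?actM (P i) x (?r i L u)"
    if "H \<in> F" "L \<in> F" "\<phi> \<in> orbit_hom G H L" "x \<in> \<phi> H" "u \<in> carrier (obj (P i) L)" for i H L \<phi> x u
  proof -
    have x: "x \<in> carrier G" by (rule G.orbit_hom_image(1)[OF sub sub that(3,4)]) fact+
    have "?r i H (arr (P i) H L \<phi> u) = arr (P i) ?I L (G.free_orbit_map (\<one>\<^bsub>G\<^esub> \<otimes>\<^bsub>G\<^esub> x) L) u"
      using orbit_module_D(4)[OF P one that(1,2) free[OF G.one_closed that(1)] that(3,5)]
      unfolding G.free_orbit_map_compose[OF sub[OF that(1)] sub[OF that(2)] that(3) G.one_closed that(4)] ..
    also have "\<one>\<^bsub>G\<^esub> \<otimes>\<^bsub>G\<^esub> x = x \<otimes>\<^bsub>G\<^esub> \<one>\<^bsub>G\<^esub>" using x by simp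
    also have "arr (P i) ?I L (G.free_orbit_map (x \<otimes>\<^bsub>G\<^esub> \<one>\<^bsub>G\<^esub>) L) u = ?actM (P i) x (?r i L u)"
      using orbit_module_D(4)[OF P one one that(2) free[OF x one] free[OF G.one_closed that(2)] that(5)]
      unfolding G.free_orbit_map_compose[OF T sub[OF that(2)] free[OF G.one_closed that(2)] x
          G.free_orbit_map_image[OF G.one_closed sub[OF that(2)]]] .
    finally show ?thesis .
  qed
  \<comment> \<open>The instance of \<open>arr_r\<close> for the identity of \<open>G/H\<close>,
    with \<open>h\<close> as representative of the coset \<open>H\<close>.\<close>
  have r_fixed: "?actM (P i) h (?r i H u) = ?r i H u"
    if "H \<in> F" "h \<in> H" "u \<in> carrier (obj (P i) H)" for i H h u
    using arr_r[OF that(1,1) orbit_hom_id[OF G.is_group sub[OF that(1)]], of h u i] that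
      orbit_module_D(3)[OF P that(1,3)] G.subgroup_in_lcosets[OF sub[OF that(1)]] by simp
  define Z where "Z = (\<lambda>H\<in>F. \<lambda>u\<in>carrier (obj (P 0) H). \<zeta> (?r 0 H u))"
  have Z_fixed: "\<zeta> (?r 0 H u) \<in> fixed_points H" if "H \<in> F" "u \<in> carrier (obj (P 0) H)" for H u
  proof -
    have "act h (\<zeta> (?r 0 H u)) = \<zeta> (?r 0 H u)" if "h \<in> H" for h
      unfolding \<zeta>_act[OF subgroup.mem_carrier[OF sub[OF \<open>H \<in> F\<close>] that]
          r_closed[OF \<open>H \<in> F\<close> \<open>u \<in> carrier (obj (P 0) H)\<close>], symmetric]
        r_fixed[OF \<open>H \<in> F\<close> that \<open>u \<in> carrier (obj (P 0) H)\<close>] ..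
    then show ?thesis
      using hom_in_carrier[OF \<zeta>_hom r_closed[OF that]] by (simp add: fixed_points_def)
  qed
  have "Z \<in> orbit_module_hom G F (P 0) ?N"
  proof (rule orbit_module_hom_I)
    fix H assume H: "H \<in> F"
    show "Z H \<in> hom (obj (P 0) H) (obj ?N H)"
      using H Z_fixed hom_mult[OF r[OF H]] hom_mult[OF \<zeta>_hom] r_closed
        monoid.m_closed[OF orbit_module_monoid[OF P H]]
      by (intro homI) (simp_all add: Z_def obj_N)
  next
    fix H L \<phi> u
    assume *: "H \<in> F" "L \<in> F" "\<phi> \<in> orbit_hom G H L" "u \<in> carrier (obj (P 0) L)"
    obtain x where x: "x \<in> \<phi> H"
      by (rule G.orbit_hom_image_nonempty[OF sub[OF *(1)] sub[OF *(2)] *(3)])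
    have "x \<in> carrier G" by (rule G.orbit_hom_image(1)[OF sub[OF *(1)] sub[OF *(2)] *(3) x])
    then show "Z H (arr (P 0) H L \<phi> u) = arr ?N H L \<phi> (Z L u)"
      using * orbit_module_arr_closed[OF P *] arr_r[OF *(1-3) x *(4)] \<zeta>_act r_closed
        arr_N[OF sub[OF *(1)] sub[OF *(2)] *(3) x Z_fixed[OF *(2,4)]]
      by (simp add: Z_def)
  qed (auto simp: Z_def)
  moreover have "\<eta> = orbit_module_comp F (P (Suc 0)) Z (d 0)"
  proof (rule extensionalityI[of _ F])
    show "\<eta> \<in> extensional F" using \<eta> by (simp add: orbit_module_hom_def PiE_iff)
    show "orbit_module_comp F (P (Suc 0)) Z (d 0) \<in> extensional F" by (simp add: orbit_module_comp_def)
    fix H assume H: "H \<in> F"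
    show "\<eta> H = orbit_module_comp F (P (Suc 0)) Z (d 0) H"
    proof (rule extensionalityI[OF orbit_module_hom_D(2)[OF \<eta> H]])
      show "orbit_module_comp F (P (Suc 0)) Z (d 0) H \<in> extensional (carrier (obj (P (Suc 0)) H))"
        using H by (simp add: orbit_module_comp_def)
      fix w assume w: "w \<in> carrier (obj (P (Suc 0)) H)"
      note fH = free[OF G.one_closed H]
      have "\<eta> H w \<in> fixed_points H"
        using orbit_module_hom_D(3)[OF \<eta> H w] by (simp add: obj_N)
      \<comment> \<open>The projection \<open>G/1 \<rightarrow> G/H\<close> is represented by the
        unit, so it induces the inclusion of fixed points; naturality then moves the computation to
        \<open>G/1\<close>.\<close>
      then have "\<eta> H w = arr ?N ?I H (G.free_orbit_map \<one>\<^bsub>G\<^esub> H) (\<eta> H w)"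
        using arr_N[OF T sub[OF H] fH G.free_orbit_map_image[OF G.one_closed sub[OF H]]]
        by (simp add: act_one fixed_points_def)
      also have "\<dots> = \<eta> ?I (?r (Suc 0) H w)"
        by (rule orbit_module_hom_nat[OF \<eta> one H fH w, symmetric])
      also have "\<dots> = \<zeta> (?r 0 H (d 0 H w))"
        using \<zeta>_d[OF r_closed[OF H w]] orbit_module_hom_nat[OF d one H fH w] by simp
      also have "\<dots> = orbit_module_comp F (P (Suc 0)) Z (d 0) H w"
        using H w orbit_module_hom_D(3)[OF d H w] by (simp add: Z_def orbit_module_comp_def compose_def)
      finally show "\<eta> H w = orbit_module_comp F (P (Suc 0)) Z (d 0) H w" .
    qed
  qed
  ultimately show "\<eta> \<in> ext_coboundaries G F P d ?N (Suc 0)"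
    by (auto simp: ext_coboundaries_def)
qed

text \<open>The form for an arbitrary \<open>G\<close>-module: vanishing of ordinary first group
  cohomology, expressed by crossed homomorphisms, is passed on to the orbit category.\<close>

theorem trivial_ext_1_fixed_point_module:
  fixes A :: "'a monoid"
  assumes GA: "group_module G A act"
    and H1: "\<And>c. c \<in> group_module.crossed_homs G A act \<Longrightarrow> group_module.principal G A act c"
    and fam: "subgroup_family G F" and one: "{\<one>\<^bsub>G\<^esub>} \<in> F"
    and res: "projective_resolution G F (constant_module integer_group) P d \<epsilon>"
  shows "trivial_group (ext_group G F P d (fixed_point_module A act) 1)"
proof -
  let ?N = "fixed_point_module A act"
  let ?C = "orbit_hom_group G F (P (Suc 0)) ?N"
  have N: "orbit_module G F ?N" by (rule orbit_module_fixed_point_module[OF GA fam])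
  have P: "orbit_module G F (P i)" and d: "d i \<in> orbit_module_hom G F (P (Suc i)) (P i)" for i
    using res by (auto simp: projective_resolution_def orbit_projective_def)
  interpret group_hom ?C "orbit_hom_group G F (P (Suc (Suc 0))) ?N"
    "\<lambda>\<eta>. orbit_module_comp F (P (Suc (Suc 0))) \<eta> (d (Suc 0))"
    by (rule orbit_module_comp_group_hom[OF P P N d])
  have "subgroup (ext_cocycles G F P d ?N (Suc 0)) ?C"
    unfolding ext_cocycles_def by (rule subgroup_kernel)
  then have "group (?C\<lparr>carrier := ext_cocycles G F P d ?N (Suc 0)\<rparr>)"
    by (rule G.subgroup_imp_group)
  from group_trivial_Mod_self[OF this] show ?thesis
    using ext_coboundaries_subset_cocycles[OF res N, of 0]
      ext_1_fixed_point_module_cocycles[OF GA H1 fam one res]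
    by (simp add: ext_group_def subset_antisym)
qed

section \<open>The multiplicative group of a Galois extension\<close>

text \<open>Beyond the ring homomorphism laws, the action must preserve the carrier of
  \<open>mult_of E\<close>; injectivity of automorphisms keeps nonzero elements nonzero.\<close>

lemma group_module_galois_units:
  assumes "field E" "K \<subseteq> carrier E"
  shows "group_module (galois_group E K) (mult_of E) (\<lambda>\<sigma> a. \<sigma> a)"
proof -
  interpret field E by fact
  have aut: "ring_hom_ring E E \<sigma>" "inj_on \<sigma> (carrier E)" if "\<sigma> \<in> carrier (galois_group E K)" for \<sigma>
    using that ring_axioms
    by (auto simp: galois_group_carrier ring_iso_def bij_betw_def intro!: ring_hom_ringI2)
  have nz: "\<sigma> a \<noteq> \<zero>\<^bsub>E\<^esub>"
    if "\<sigma> \<in> carrier (galois_group E K)" "a \<in> carrier E" "a \<noteq> \<zero>\<^bsub>E\<^esub>" for \<sigma> a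
  proof -
    interpret \<sigma>: ring_hom_ring E E \<sigma> by (rule aut[OF that(1)])
    show ?thesis using inj_onD[OF aut(2)[OF that(1)], of a "\<zero>\<^bsub>E\<^esub>"] that by auto
  qed
  show ?thesis
  proof (intro group_module.intro group_module_axioms.intro)
    show "group (galois_group E K)" by (rule group_galois_group[OF ring_axioms assms(2)])
    show "comm_group (mult_of E)"
      using units_comm_group by (simp add: Ring_Divisibility.mult_of_def units_of_def field_Units)
    show "\<sigma> \<in> hom (mult_of E) (mult_of E)" if "\<sigma> \<in> carrier (galois_group E K)" for \<sigma>
    proof -
      interpret \<sigma>: ring_hom_ring E E \<sigma> by (rule aut[OF that])
      show ?thesis using nz[OF that] by (intro homI) auto
    qed
    show "\<one>\<^bsub>galois_group E K\<^esub> a = a" if "a \<in> carrier (mult_of E)" for a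
      using that by (simp add: galois_group_one)
    show "(\<sigma> \<otimes>\<^bsub>galois_group E K\<^esub> \<tau>) a = \<sigma> (\<tau> a)"
      if "\<sigma> \<in> carrier (galois_group E K)" "\<tau> \<in> carrier (galois_group E K)" "a \<in> carrier (mult_of E)" for \<sigma> \<tau> a
      using that by (simp add: galois_group_mult compose_eq)
  qed
qed

text \<open>The resolution is arbitrary, as is the type of its elements, so the vanishing does not
  depend on a choice; \<open>bar_resolution\<close> supplies an instance.\<close>

theorem lemma6p1:
  fixes E :: "('e, 'm) ring_scheme"
    and K :: "'e set"
    and F :: "('e \<Rightarrow> 'e) set set"
    and P :: "nat \<Rightarrow> ('e \<Rightarrow> 'e, 'p) orb_mod"
    and d :: "nat \<Rightarrow> ('e \<Rightarrow> 'e) set \<Rightarrow> 'p \<Rightarrow> 'p"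
    and \<epsilon> :: "('e \<Rightarrow> 'e) set \<Rightarrow> 'p \<Rightarrow> int"
  assumes "finite_galois_extension E K"
    and "subgroup_family (galois_group E K) F"
    and "{\<one>\<^bsub>galois_group E K\<^esub>} \<in> F"
    and "projective_resolution (galois_group E K) F (constant_module integer_group) P d \<epsilon>"
  shows "trivial_group (ext_group (galois_group E K) F P d (galois_units_module E) 1)"
proof -
  have E: "field E" "K \<subseteq> carrier E"
    using assms(1) subfieldE(3) by (auto simp: finite_galois_extension_def)
  interpret group_module "galois_group E K" "mult_of E" "\<lambda>\<sigma> a. \<sigma> a"
    by (rule group_module_galois_units[OF E])
  have "principal c" if c: "c \<in> crossed_homs" for c
  proof -
    obtain b where "b \<in> carrier (mult_of E)"
      "\<And>\<sigma>. \<sigma> \<in> carrier (galois_group E K) \<Longrightarrow> \<sigma> b = c \<sigma> \<otimes>\<^bsub>E\<^esub> b"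
      by (rule hilbert_90[OF assms(1), of c]) (use c in \<open>auto simp: crossed_homs_def\<close>)
    then show ?thesis by (auto simp: principal_def)
  qed
  then show ?thesis
    unfolding galois_units_module_def
    by (rule trivial_ext_1_fixed_point_module[OF group_module_axioms _ assms(2-4)])
qed

end
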